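(* Let $k_0\in\mathbb{N}$, $0<\epsilon<\pi/2$, $U\in(0,\pi/2-\epsilon]$, $\Delta>0$, and $1\le \bar k_\Delta,k_1,k_2\le k_0$. For $L\in\mathbb{N}$ large consider on $[\pi L,\pi L+U]$ the functions $$f_1(t)=\frac1{\cos^2t},\qquad f_2(t)=\frac{\sin^2t}{\cos^4t},\qquad \bar f_\Delta(t)=(t-\pi L)^\Delta ,$$ and write (with $T=\pi L$) $\alpha_r^{1,k_1}=\alpha_r^{f_1,k_1}$, $\alpha_r^{2,k_2}=\alpha_r^{f_2,k_2}$, $\bar\alpha_r^{\Delta,\bar k_\Delta}=\alpha_r^{\bar f_\Delta,\bar k_\Delta}$ and $\beta_r^{k}$ for the associated points defined in the context. Then, as $L\to\infty$, $$\prod_{r=1}^{\bar k_\Delta}\left|\frac{\zeta(\frac12+i\bar\alpha_r^{\Delta,\bar k_\Delta})}{\zeta(\frac12+i\beta_r^{\bar k_\Delta})}\right|^2\sim\frac{3^{\Delta/2}}{1+\Delta}\left[\frac{|\cos^3(\alpha_0^{1,k_1})|\,|\sin(\alpha_0^{2,k_2})|}{(\bar\alpha_0^{\Delta,\bar k_\Delta}-\pi L)\cos^2(\alpha_0^{2,k_2})}\right]^\Delta\left\{\prod_{r=1}^{k_1}\left|\frac{\zeta(\frac12+i\alpha_r^{1,k_1})}{\zeta(\frac12+i\beta_r^{k_1})}\right|^2\right\}^{-3\Delta/2}\left\{\prod_{r=1}^{k_2}\left|\frac{\zeta(\frac12+i\alpha_r^{2,k_2})}{\zeta(\frac12+i\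beta_r^{k_2})}\right|^2\right\}^{\Delta/2}.$$
   Context: Notation. $\zeta$ is the Riemann zeta-function, $Z(t)$ is Hardy's function (so $|Z(t)|=|\zeta(\frac12+it)|$). $A\sim B$ means $A/B\to1$. Jacob's ladder. Let $\mu\in C^\infty([y_0,\infty))$ be a fixed increasing unbounded function with $\mu(y)\ge 7y\ln y$. For all sufficiently large $T$ the equation $\int_0^{\mu[x(T)]}Z^2(t)e^{-2t/x(T)}\,dt=\int_0^T Z^2(t)\,dt$ has a unique solution $x(T)=\varphi(T)$. Put $\varphi_1=\frac12\varphi$ (Jacob's ladder). It is strictly increasing and unbounded, and $\tilde Z^2(t):=\varphi_1'(t)=|\zeta(\frac12+it)|^2/\omega(t)$, $\omega(t)=\{1+O(\ln\ln t/\ln t)\}\ln t$. Write $\varphi_1^0(t)=t$, $\varphi_1^{r}=\varphi_1\circ\varphi_1^{r-1}$, and for large $T$ let $\overset{r}{T}$ be defined by $\varphi_1^r(\overset{r}{T})=T$. The class $\tilde C_0[T,T+U]$, $U=o(T/\ln T)$, consists of the continuous functions $f$ on $[T,T+U]$ that do not change sign and are not identically zero. Associated points. Let $1\le k\le k_0$. For $f\in\tilde C_0[T,T+U]$ the substitution rule and the mean value theorem give a point $d\in(\overset{k}{T},\overset{k}{\overset{\frown}{T+U}})$, where $\overset{k}{\overset{\frown}{T+U}}$ denotes the point with $\varphi_1^k(\overset{k}{\overset{\frown}{T+U}})=T+U$, such that $$\int_T^{T+U}f(t)\,dt=f(\varphi_1^k(d))\prod_{r=0}^{k-1}\tilde Z^2(\varphi_1^r(d))\cdot\bigl(\overset{k}{\overset{\frown}{T+U}}-\overset{k}{T}\bigr);$$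 fix such $d=d(U,T,k;f)$ and put $\alpha_r^{f,k}=\varphi_1^{k-r}(d)$, $r=0,1,\dots,k$ (so $T<\alpha_0^{f,k}<T+U$). For $f\equiv1$ fix in the same way a point $e=e(U,T,k)$ and put $\beta_r^{k}=\varphi_1^{k-r}(e)$, $r=1,\dots,k$. *)

theory Defs
  imports "HOL-Analysis.Analysis" "HOL-Library.Landau_Symbols"
begin

(* The analytic continuation of the Dirichlet series to every half-plane Re z > a, with the
   point 1 removed. Such half-planes are nested and connected, so the value at s does not depend
   on a or f. It is left unspecified at the pole s = 1. *)
definition zeta :: "complex \<Rightarrow> complex" where
  "zeta s = (THE w. \<exists>a f. a < Re s \<and> f holomorphic_on ({z. a < Re z} - {1}) \<and>
     (\<forall>z. 1 < Re z \<longrightarrow> (\<lambda>n. 1 / of_nat (Suc n) powr z) sums f z) \<and> w = f s)"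

abbreviation zeta_crit :: "real \<Rightarrow> complex" where
  "zeta_crit t \<equiv> zeta (Complex (1/2) t)"

definition siegel_theta :: "real \<Rightarrow> real" where
  "siegel_theta t = Im (ln_Gamma (Complex (1/4) (t/2))) - t/2 * ln pi"

(* The product is real by the functional equation, so Re only changes the type. *)
definition hardy_Z :: "real \<Rightarrow> real" where
  "hardy_Z t = Re (cis (siegel_theta t) * zeta_crit t)"

(* C-infinity on [a, \<infinity>); at the endpoint a the derivatives are one-sided. *)
definition smooth_from :: "real \<Rightarrow> (real \<Rightarrow> real) \<Rightarrow> bool" where
  "smooth_from a g \<longleftrightarrow> (\<exists>D :: nat \<Rightarrow> real \<Rightarrow> real. (\<forall>y\<ge>a. D 0 y = g y) \<and>
     (\<forall>n. \<forall>y\<ge>a. (D n has_real_derivative D (Suc n) y) (at y within {a..})))"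

definition ladder_weight :: "real \<Rightarrow> (real \<Rightarrow> real) \<Rightarrow> bool" where
  "ladder_weight y0 \<mu> \<longleftrightarrow> 0 < y0 \<and> smooth_from y0 \<mu> \<and> mono_on {y0..} \<mu> \<and>
     \<not> bdd_above (\<mu> ` {y0..}) \<and> (\<forall>y\<ge>y0. 7 * y * ln y \<le> \<mu> y)"

definition ladder_equation :: "(real \<Rightarrow> real) \<Rightarrow> real \<Rightarrow> real \<Rightarrow> bool" where
  "ladder_equation \<mu> T x \<longleftrightarrow>
     integral {0..\<mu> x} (\<lambda>t. (hardy_Z t)\<^sup>2 * exp (- 2 * t / x)) = integral {0..T} (\<lambda>t. (hardy_Z t)\<^sup>2)"

(* From T0 on, \<phi> T is the unique solution of the equation; values of \<phi> below T0 are irrelevant. *)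
definition ladder_solution ::
    "real \<Rightarrow> (real \<Rightarrow> real) \<Rightarrow> real \<Rightarrow> (real \<Rightarrow> real) \<Rightarrow> bool" where
  "ladder_solution y0 \<mu> T0 \<phi> \<longleftrightarrow>
     (\<forall>T\<ge>T0. y0 \<le> \<phi> T \<and> (\<forall>x\<ge>y0. ladder_equation \<mu> T x \<longleftrightarrow> x = \<phi> T))"

(* The point x with \<phi>1^r x = T, where \<phi>1 counts as a partial function with domain [T0, \<infinity>):
   the set is the domain of its r-th iterate. *)
definition ladder_preimage :: "real \<Rightarrow> (real \<Rightarrow> real) \<Rightarrow> nat \<Rightarrow> real \<Rightarrow> real" where
  "ladder_preimage T0 \<phi>1 r T = the_inv_into {x. \<forall>j<r. T0 \<le> (\<phi>1 ^^ j) x} (\<phi>1 ^^ r) T"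

(* d is an admissible choice of the mean-value point d(U,T,k;f); deriv \<phi>1 is the paper's
   \<open>Z-tilde squared\<close>. *)
definition mean_value_point ::
    "real \<Rightarrow> (real \<Rightarrow> real) \<Rightarrow> real \<Rightarrow> real \<Rightarrow> nat \<Rightarrow> (real \<Rightarrow> real) \<Rightarrow> real \<Rightarrow> bool" where
  "mean_value_point T0 \<phi>1 U T k f d \<longleftrightarrow>
     d \<in> {ladder_preimage T0 \<phi>1 k T <..< ladder_preimage T0 \<phi>1 k (T + U)} \<and>
     integral {T..T + U} f =
       f ((\<phi>1 ^^ k) d) * (\<Prod>r<k. deriv \<phi>1 ((\<phi>1 ^^ r) d)) *
       (ladder_preimage T0 \<phi>1 k (T + U) - ladder_preimage T0 \<phi>1 k T)"

(* The points \<alpha>_r (and \<beta>_r) generated by d (by e). *)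
definition assoc_pt :: "(real \<Rightarrow> real) \<Rightarrow> nat \<Rightarrow> real \<Rightarrow> nat \<Rightarrow> real" where
  "assoc_pt \<phi>1 k d r = (\<phi>1 ^^ (k - r)) d"

definition zeta_quotient :: "(real \<Rightarrow> real) \<Rightarrow> nat \<Rightarrow> real \<Rightarrow> real \<Rightarrow> real" where
  "zeta_quotient \<phi>1 k d e =
     (\<Prod>r=1..k. (cmod (zeta_crit (assoc_pt \<phi>1 k d r) / zeta_crit (assoc_pt \<phi>1 k e r)))\<^sup>2)"

end

(* With D the product of the values of phi1' along the orbit of d, and E the same product for e,
   the two mean value equations give D/E = (integral of f) / (U f(alpha_0)). Since
   phi1' = |zeta|^2/omega, the zeta quotient is D/E times a product of quotients
   omega(alpha_r)/omega(beta_r). Once these tend to 1, the theorem is an identity between the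
   integrals tan U, (tan U)^3/3 and U^(Delta+1)/(Delta+1).

   As omega t ~ ln t, it suffices that the r-fold preimages of T and T + U differ at most by a
   factor 2. The integral of |zeta(1/2+it)|^2 over [t, t + t^delta] is at least c t^delta/(ln t)^2:
   move the Gaussian-weighted integral of zeta to the line Re s = 3, where Re zeta >= 1/6. So phi1
   maps [t, t + t^delta] onto an interval longer than t^(delta/2), and with the trivial bound
   phi1 t <= t^4 the preimages stay close by induction on r. *)

theory Submission
  imports Defs "HOL-Complex_Analysis.Complex_Analysis" "HOL-Real_Asymp.Real_Asymp"
begin

section \<open>The zeta function on the right half-plane\<close>

text \<open>The points \<open>d\<close> and \<open>e\<close> are only known to lie in the same
  interval between two preimages, and no hypothesis bounds its length. The derivative of the ladder
  vanishes at the zeros of zeta, so such a bound has to come from a lower mean value estimate on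
  short intervals. Each step back through the ladder divides the admissible exponent by 8, hence the
  estimate is needed for every positive exponent, and a mean value formula whose error is a fixed
  power of t would not do. The Gaussian argument reaches down to intervals of length about ln t, and
  the powers of ln t that it loses are harmless. A second obstacle is the domain. The preimages
  refer to the ladder on [T0, \<infinity>), while the derivative formula holds only beyond some
  larger T1. Monotonicity on all of [T0, \<infinity>), obtained from the uniqueness of the solution
  of the ladder equation, rules out a further preimage between T0 and T1.\<close>

definition zeta_term :: "nat \<Rightarrow> complex \<Rightarrow> complex" where
  "zeta_term n s = of_nat (Suc n) powr (-s) -
     (of_nat (Suc n) powr (1 - s) - of_nat (Suc (Suc n)) powr (1 - s)) / (s - 1)"

text \<open>With m = n + 1, \<open>zeta_term n s\<close> is m^(-s) minus the integral of u^(-s) over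
  [m, m+1]. For Re s > 1 these integrals add up to 1/(s - 1), and the differences are still summable
  for Re s > 0, so this is the Euler-Maclaurin continuation of order one.\<close>

definition zeta_sum :: "complex \<Rightarrow> complex" where
  "zeta_sum s = 1 / (s - 1) + (\<Sum>n. zeta_term n s)"

text \<open>The term is the error of a first-order Taylor expansion of a primitive of \<open>u powr (- s)\<close>.\<close>

lemma norm_zeta_term_le:
  assumes "0 < Re s" "s \<noteq> 1"
  shows "norm (zeta_term n s) \<le> norm s * real (Suc n) powr (- Re s - 1)"
proof -
  define f :: "nat \<Rightarrow> complex \<Rightarrow> complex" where
    "f i u = (if i = 0 then u powr (1 - s) / (1 - s) else if i = 1 then u powr (-s)
              else - s * u powr (- s - 1))" for i u
  define S where "S = closed_segment (of_nat (Suc n) :: complex) (of_nat (Suc (Suc n)))"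
  have S: "\<exists>x\<ge>real (Suc n). u = of_real x" if "u \<in> S" for u
  proof -
    from that obtain t where t: "0 \<le> t" "t \<le> 1"
      "u = (1 - t) *\<^sub>R of_nat (Suc n) + t *\<^sub>R (of_nat (Suc (Suc n)) :: complex)"
      unfolding S_def in_segment by blast
    have "u = of_real (real (Suc n) + t)"
      unfolding t(3) by (simp add: complex_eq_iff algebra_simps)
    then show ?thesis using t(1) by (intro exI[of _ "real (Suc n) + t"]) auto
  qed
  have nonpos: "u \<notin> \<real>\<^sub>\<le>\<^sub>0" if u: "u \<in> S" for u
    using S[OF u] by (auto simp: complex_nonpos_Reals_iff)
  have "norm (f 0 (of_nat (Suc (Suc n))) -
        (\<Sum>i\<le>1. f i (of_nat (Suc n)) * (of_nat (Suc (Suc n)) - of_nat (Suc n)) ^ i / fact i))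
      \<le> (norm s * real (Suc n) powr (- Re s - 1)) *
         norm (of_nat (Suc (Suc n)) - of_nat (Suc n) :: complex) ^ Suc 1 / fact 1"
  proof (rule complex_Taylor[where S = S])
    fix i :: nat and u assume u: "u \<in> S" and i: "i \<le> 1"
    show "(f i has_field_derivative f (Suc i) u) (at u within S)"
    proof (cases "i = 0")
      case True
      have "((\<lambda>u. u powr (1 - s) / (1 - s)) has_field_derivative (1 - s) * u powr (1 - s - 1) / (1 - s)) (at u within S)"
        using nonpos[OF u] by (auto intro!: derivative_eq_intros)
      then show ?thesis using True assms by (simp add: f_def[abs_def])
    next
      case False
      then have i1: "i = 1" using i by auto
      have "((\<lambda>u. u powr (- s)) has_field_derivative (- s) * u powr (- s - 1)) (at u within S)"
        using nonpos[OF u] by (auto intro!: derivative_eq_intros)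
      then show ?thesis using i1 by (simp add: f_def[abs_def])
    qed
  next
    fix u assume u: "u \<in> S"
    then obtain x where x: "x \<ge> real (Suc n)" "u = of_real x" using S by blast
    have "norm (u powr (- s - 1)) = x powr (- Re s - 1)"
      using x by (simp add: norm_powr_real_powr)
    also have "\<dots> \<le> real (Suc n) powr (- Re s - 1)"
      using x assms by (intro powr_mono2') auto
    finally show "norm (f (Suc 1) u) \<le> norm s * real (Suc n) powr (- Re s - 1)"
      by (simp add: f_def norm_mult mult_left_mono)
  qed (auto simp: S_def)
  also have "f 0 (of_nat (Suc (Suc n))) -
        (\<Sum>i\<le>1. f i (of_nat (Suc n)) * (of_nat (Suc (Suc n)) - of_nat (Suc n)) ^ i / fact i)
     = - zeta_term n s"
  proof -
    have *: "{..1::nat} = {0,1}" by auto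
    have m: "x / (1 - s) = - (x / (s - 1))" for x
      by (metis minus_diff_eq divide_minus_right)
    show ?thesis
      unfolding * zeta_term_def f_def by (simp add: m diff_divide_distrib)
  qed
  finally show ?thesis by simp
qed

lemma summable_Suc_powr: "a < -1 \<Longrightarrow> summable (\<lambda>n. real (Suc n) powr a)"
  using summable_Suc_iff[of "\<lambda>n. real n powr a"] summable_real_powr_iff[of a] by simp

lemma summable_zeta_term:
  assumes "0 < Re s" "s \<noteq> 1"
  shows "summable (\<lambda>n. zeta_term n s)"
  using norm_zeta_term_le[OF assms] assms
  by (intro summable_comparison_test'[OF summable_mult[OF summable_Suc_powr, of "- Re s - 1" "norm s"]])
     auto

lemma holomorphic_zeta_sum: "zeta_sum holomorphic_on ({s. 0 < Re s} - {1})"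
proof -
  let ?S = "{s. 0 < Re s} - {1::complex}"
  have op: "open ?S" by (intro open_Diff open_halfspace_Re_gt) auto
  have "(\<lambda>s. \<Sum>n. zeta_term n s) holomorphic_on ?S"
  proof (rule holomorphic_uniform_sequence[OF op])
    show "(\<lambda>s. \<Sum>n<N. zeta_term n s) holomorphic_on ?S" for N
      unfolding zeta_term_def by (intro holomorphic_intros) auto
  next
    fix x assume x: "x \<in> ?S"
    then obtain d where d: "d > 0" "cball x d \<subseteq> ?S" using op open_contains_cball by blast
    \<comment> \<open>The real part of the leftmost point of the disc: the majorant needs one
      exponent that serves the whole disc.\<close>
    define \<delta> where "\<delta> = Re (x - of_real d)"
    have "x - of_real d \<in> cball x d" using d by (auto simp: dist_norm)
    from subsetD[OF d(2) this] have \<delta>: "\<delta> > 0" by (simp add: \<delta>_def)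
    have "uniform_limit (cball x d) (\<lambda>N s. \<Sum>n<N. zeta_term n s) (\<lambda>s. \<Sum>n. zeta_term n s) sequentially"
    proof (rule Weierstrass_m_test)
      show "summable (\<lambda>n. (norm x + d) * real (Suc n) powr (- \<delta> - 1))"
        using \<delta> by (intro summable_mult summable_Suc_powr) auto
      fix n s assume s: "s \<in> cball x d"
      have "norm (x - s) \<le> d" using s by (simp add: dist_norm)
      then have "norm s \<le> norm x + d"
        by (smt (verit, best) norm_minus_commute norm_triangle_ineq2)
      moreover have "Re s \<ge> \<delta>"
        using abs_Re_le_cmod[of "x - s"] \<open>norm (x - s) \<le> d\<close> by (simp add: \<delta>_def)
      ultimately have "norm s * real (Suc n) powr (- Re s - 1) \<le> (norm x + d) * real (Suc n) powr (- \<delta> - 1)"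
        by (intro mult_mono powr_mono) (use d in auto)
      moreover have "0 < Re s" "s \<noteq> 1" using s d by auto
      ultimately show "norm (zeta_term n s) \<le> (norm x + d) * real (Suc n) powr (- \<delta> - 1)"
        using norm_zeta_term_le[of s n] by linarith
    qed
    then show "\<exists>d>0. cball x d \<subseteq> ?S \<and>
      uniform_limit (cball x d) (\<lambda>N s. \<Sum>n<N. zeta_term n s) (\<lambda>s. \<Sum>n. zeta_term n s) sequentially"
      using d by blast
  qed
  then show ?thesis
    unfolding zeta_sum_def[abs_def] by (intro holomorphic_intros) auto
qed

lemma dirichlet_sums_zeta_sum:
  assumes "1 < Re z"
  shows "(\<lambda>n. 1 / of_nat (Suc n) powr z) sums zeta_sum z"
proof -
  have z: "0 < Re z" "z \<noteq> 1" using assms by auto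
  have eq: "1 / of_nat (Suc n) powr z = zeta_term n z +
     (of_nat (Suc n) powr (1 - z) - of_nat (Suc (Suc n)) powr (1 - z)) / (z - 1)" for n
    by (simp add: zeta_term_def powr_minus field_simps)
  have "(\<lambda>n. of_nat (Suc n) powr (1 - z)) \<longlonglongrightarrow> (0::complex)"
  proof (rule tendsto_norm_zero_cancel)
    have "filterlim (\<lambda>n. real (Suc n)) at_top sequentially"
      by (rule filterlim_compose[OF filterlim_real_sequentially filterlim_Suc])
    from tendsto_neg_powr[OF _ this, of "1 - Re z"] assms
    have "(\<lambda>n. real (Suc n) powr (1 - Re z)) \<longlonglongrightarrow> 0" by simp
    then show "(\<lambda>n. norm (of_nat (Suc n) powr (1 - z) :: complex)) \<longlonglongrightarrow> 0"
      by (simp add: norm_powr_real_powr del: of_nat_Suc)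
  qed
  from telescope_sums'[OF this]
  have "(\<lambda>n. of_nat (Suc n) powr (1 - z) - of_nat (Suc (Suc n)) powr (1 - z)) sums (1::complex)"
    by simp
  from sums_add[OF summable_sums[OF summable_zeta_term[OF z]] sums_divide[OF this, of "z - 1"]]
  show ?thesis unfolding eq zeta_sum_def by (simp add: add_ac)
qed

text \<open>The description in \<open>zeta\<close> ranges over continuations to arbitrary
  half-planes. Such an \<open>f\<close> is compared with \<open>zeta_sum\<close> on the part common
  to both domains, which still contains \<open>s\<close>, stays connected without the point 1, and
  meets the region of the Dirichlet series.\<close>

lemma zeta_eq_zeta_sum:
  assumes "0 < Re s" "s \<noteq> 1"
  shows "zeta s = zeta_sum s"
  unfolding zeta_def
proof (rule the_equality)
  show "\<exists>a f. a < Re s \<and> f holomorphic_on ({z. a < Re z} - {1}) \<and>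
     (\<forall>z. 1 < Re z \<longrightarrow> (\<lambda>n. 1 / of_nat (Suc n) powr z) sums f z) \<and> zeta_sum s = f s"
    using assms holomorphic_zeta_sum dirichlet_sums_zeta_sum
    by (intro exI[of _ 0] exI[of _ zeta_sum]) auto
next
  fix w assume "\<exists>a f. a < Re s \<and> f holomorphic_on ({z. a < Re z} - {1}) \<and>
     (\<forall>z. 1 < Re z \<longrightarrow> (\<lambda>n. 1 / of_nat (Suc n) powr z) sums f z) \<and> w = f s"
  then obtain a f where f: "a < Re s" "f holomorphic_on ({z. a < Re z} - {1})"
     "\<And>z. 1 < Re z \<Longrightarrow> (\<lambda>n. 1 / of_nat (Suc n) powr z) sums f z" "w = f s" by blast
  define b where "b = max a 0"
  have op: "open {z. b < Re z}" "open {z. max b 1 < Re z}" by (rule open_halfspace_Re_gt)+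
  have "f s = zeta_sum s"
  proof (rule analytic_continuation_open[where f = f and g = zeta_sum and s = "{z. max b 1 < Re z}" and s' = "{z. b < Re z} - {1}"])
    show "{z. max b 1 < Re z} \<noteq> {}"
      by (auto intro!: exI[of _ "of_real (max b 1 + 1)"])
    show "connected ({z. b < Re z} - {1})"
      by (intro connected_open_delete convex_connected open_halfspace_Re_gt convex_halfspace_Re_gt) auto
    show "f holomorphic_on ({z. b < Re z} - {1})"
      by (rule holomorphic_on_subset[OF f(2)]) (auto simp: b_def)
    show "zeta_sum holomorphic_on ({z. b < Re z} - {1})"
      by (rule holomorphic_on_subset[OF holomorphic_zeta_sum]) (auto simp: b_def)
    show "f z = zeta_sum z" if "z \<in> {z. max b 1 < Re z}" for z
      using f(3)[of z] dirichlet_sums_zeta_sum[of z] that sums_unique2 by auto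
  qed (use assms f op in \<open>auto simp: b_def intro!: open_Diff simp del: max_less_iff_conj\<close>)
  then show "w = zeta_sum s" using f by simp
qed

section \<open>Continuity, growth and nonvanishing of zeta\<close>

lemma holomorphic_zeta: "zeta holomorphic_on ({s. 0 < Re s} - {1})"
  using holomorphic_zeta_sum by (rule holomorphic_transform) (auto simp: zeta_eq_zeta_sum)

lemma continuous_on_zeta_crit: "continuous_on A zeta_crit"
proof -
  have "continuous_on (UNIV::real set) (\<lambda>t. zeta (Complex (1/2) t))"
    by (rule continuous_on_compose2[OF holomorphic_on_imp_continuous_on[OF holomorphic_zeta]])
       (auto simp: Complex_eq complex_eq_iff intro!: continuous_intros)
  then show ?thesis by (rule continuous_on_subset) auto
qed

text \<open>Any polynomial bound would serve, since it only has to lose against the Gaussian weight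
  exp(-(ln T)^2). The condition Im s \<ge> 1 keeps \<open>s\<close> away from the pole.\<close>

lemma zeta_norm_bound:
  obtains C where "1 \<le> C" "\<And>s. 1/2 \<le> Re s \<Longrightarrow> 1 \<le> Im s \<Longrightarrow> norm (zeta s) \<le> C * norm s"
proof
  define A where "A = (\<Sum>n. real (Suc n) powr (- 3/2))"
  have sm: "summable (\<lambda>n. real (Suc n) powr (- 3/2))" by (rule summable_Suc_powr) auto
  have A0: "A \<ge> 0" unfolding A_def by (intro suminf_nonneg sm) auto
  then show "1 \<le> 1 + A" by simp
  fix s assume s: "1/2 \<le> Re s" "1 \<le> Im s"
  have s1: "0 < Re s" "s \<noteq> 1" using s by auto
  have le: "norm (zeta_term n s) \<le> norm s * real (Suc n) powr (- 3/2)" for n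
    using norm_zeta_term_le[OF s1, of n] s
      mult_left_mono[OF powr_mono[of "- Re s - 1" "- 3/2" "real (Suc n)"] norm_ge_zero[of s]]
    by auto
  have sm2: "summable (\<lambda>n. norm (zeta_term n s))"
    using le by (intro summable_comparison_test'[OF summable_mult[OF sm, of "norm s"]]) auto
  have "norm (\<Sum>n. zeta_term n s) \<le> (\<Sum>n. norm (zeta_term n s))"
    by (rule summable_norm[OF sm2])
  also have "\<dots> \<le> norm s * A" unfolding A_def
    by (subst suminf_mult[OF sm, symmetric]) (intro suminf_le le sm2 summable_mult sm)
  finally have 1: "norm (\<Sum>n. zeta_term n s) \<le> norm s * A" .
  have "1 \<le> norm (s - 1)" using abs_Im_le_cmod[of "s - 1"] s by simp
  then have 2: "norm (1 / (s - 1)) \<le> 1" by (simp add: norm_divide divide_le_eq_1)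
  have 3: "1 \<le> norm s" using abs_Im_le_cmod[of s] s by simp
  have "norm (zeta s) \<le> 1 + norm s * A"
    unfolding zeta_eq_zeta_sum[OF s1] zeta_sum_def
    by (rule order_trans[OF norm_triangle_ineq]) (use 1 2 in linarith)
  also have "\<dots> \<le> (1 + A) * norm s" using 3 by (simp add: algebra_simps)
  finally show "norm (zeta s) \<le> (1 + A) * norm s" .
qed

text \<open>On the line \<open>Re s = 3\<close> the crude bound \<open>pi < 4\<close> suffices to keep the tail below 1.\<close>

lemma Re_zeta_3_ge: "1/6 \<le> Re (zeta (Complex 3 t))"
proof -
  let ?s = "Complex 3 t"
  have z: "zeta ?s = zeta_sum ?s" by (rule zeta_eq_zeta_sum) (auto simp: complex_eq_iff)
  have "(\<lambda>n. 1 / of_nat (Suc n) powr ?s) sums zeta ?s"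
    unfolding z by (rule dirichlet_sums_zeta_sum) auto
  then have tail: "(\<lambda>n. 1 / of_nat (Suc (Suc n)) powr ?s) sums (zeta ?s - 1)"
    using sums_Suc_iff[of "\<lambda>n. 1 / of_nat (Suc n) powr ?s" "zeta ?s - 1"] by simp
  have basel: "(\<lambda>n. 1 / (real (Suc (Suc n)))\<^sup>2) sums (pi\<^sup>2 / 6 - 1)"
    using sums_Suc_iff[of "\<lambda>n. 1 / (real (Suc n))\<^sup>2" "pi\<^sup>2 / 6 - 1"] inverse_squares_sums
    by (simp add: add_ac)
  \<comment> \<open>One of the three factors of the cube is at least 2, which leaves half of the
    tail of the Basel series.\<close>
  have le: "norm (1 / of_nat (Suc (Suc n)) powr ?s :: complex) \<le> 1/2 * (1 / (real (Suc (Suc n)))\<^sup>2)" for n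
  proof -
    have "norm (1 / of_nat (Suc (Suc n)) powr ?s :: complex) = 1 / real (Suc (Suc n)) powr 3"
      by (simp add: norm_divide norm_powr_real_powr del: of_nat_Suc)
    also have "\<dots> = 1 / (real (Suc (Suc n)))^3"
      by (subst powr_numeral) auto
    also have "\<dots> \<le> 1/2 * (1 / (real (Suc (Suc n)))\<^sup>2)"
      by (simp add: power3_eq_cube power2_eq_square divide_simps)
    finally show ?thesis .
  qed
  have "norm (zeta ?s - 1) \<le> 1/2 * (pi\<^sup>2 / 6 - 1)"
    using norm_sums_le[OF tail sums_mult[OF basel] le] .
  also have "\<dots> \<le> 5/6"
  proof -
    have "pi\<^sup>2 \<le> 4\<^sup>2" using pi_less_4 pi_gt_zero by (intro power_mono) auto
    then show ?thesis by simp
  qed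
  finally have "norm (zeta ?s - 1) \<le> 5/6" .
  then show ?thesis using abs_Re_le_cmod[of "zeta ?s - 1"] by simp
qed

text \<open>The identity theorem in the open first quadrant, which avoids the pole and contains 3 +
  i, where zeta does not vanish. This is what makes the ladder strictly increasing.\<close>

lemma zeta_crit_not_zero_on_interval:
  assumes "0 \<le> a" "a < b"
  shows "\<exists>t\<in>{a<..<b}. zeta_crit t \<noteq> 0"
proof -
  let ?S = "{s. 0 < Re s} \<inter> {s. 0 < Im s}"
  have S: "open ?S" "connected ?S"
    by (auto intro!: open_Int open_halfspace_Re_gt open_halfspace_Im_gt convex_connected convex_Int
        convex_halfspace_Re_gt convex_halfspace_Im_gt)
  have hol: "zeta holomorphic_on ?S"
    by (rule holomorphic_on_subset[OF holomorphic_zeta]) auto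
  show ?thesis
  proof (rule ccontr)
    assume neg: "\<not> (\<exists>t\<in>{a<..<b}. zeta_crit t \<noteq> 0)"
    define m where "m = (a + b) / 2"
    have m: "a < m" "m < b" using assms by (auto simp: m_def)
    have z: "zeta_crit t = 0" if "a < t" "t < b" for t using that neg by auto
    have "zeta (Complex 3 1) = 0"
    proof (rule analytic_continuation[OF hol S, of "Complex (1/2) ` {a<..<b}" "Complex (1/2) m"])
      show "Complex (1/2) m islimpt Complex (1/2) ` {a<..<b}"
        unfolding islimpt_approachable
      proof (intro allI impI)
        fix e :: real assume e: "e > 0"
        define t where "t = min (e/2) ((b - m) / 2)"
        have t: "t > 0" "t < e" "m + t < b" "a < m + t"
          using m e by (auto simp: t_def min_def field_simps)
        have "dist (Complex (1/2) (m + t)) (Complex (1/2) m) = t"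
          using t by (simp add: dist_norm cmod_def)
        then show "\<exists>x'\<in>Complex (1/2) ` {a<..<b}. x' \<noteq> Complex (1/2) m \<and> dist x' (Complex (1/2) m) < e"
          using t by (intro bexI[of _ "Complex (1/2) (m + t)"] conjI imageI) simp_all
      qed
    qed (use assms m z in auto)
    then show False using Re_zeta_3_ge[of 1] by simp
  qed
qed

section \<open>Mean values over short intervals of the critical line\<close>

text \<open>Cauchy's theorem for a rectangle, by means of a primitive \<open>F\<close>. The vertical
  integrals are increments of \<open>F\<close> up to the factor \<i>, and the four corner values
  regroup into the two horizontal increments, each at most M(q - p).\<close>

lemma vertical_integrals_diff_le:
  assumes "open S" "convex S" "f holomorphic_on S" "a \<le> b" "p \<le> q"
    and S: "\<And>x y. p \<le> x \<Longrightarrow> x \<le> q \<Longrightarrow> a \<le> y \<Longrightarrow> y \<le> b \<Longrightarrow> Complex x y \<in> S"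
    and M: "\<And>x. p \<le> x \<Longrightarrow> x \<le> q \<Longrightarrow> norm (f (Complex x a)) \<le> M"
           "\<And>x. p \<le> x \<Longrightarrow> x \<le> q \<Longrightarrow> norm (f (Complex x b)) \<le> M"
  shows "norm (integral {a..b} (\<lambda>y. f (Complex q y)) - integral {a..b} (\<lambda>y. f (Complex p y)))
     \<le> 2 * M * (q - p)"
proof -
  obtain F where F: "\<And>x. x \<in> S \<Longrightarrow> (F has_field_derivative f x) (at x)"
    using holomorphic_convex_primitive'[OF assms(2,1,3)] assms(1)
    by (metis at_within_open)
  have vert: "\<i> * integral {a..b} (\<lambda>y. f (Complex x y)) = F (Complex x b) - F (Complex x a)"
    if x: "p \<le> x" "x \<le> q" for x
  proof -
    have "((\<lambda>y. f (Complex x y) * \<i>) has_integral F (Complex x b) - F (Complex x a)) {a..b}"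
    proof (rule fundamental_theorem_of_calculus[OF \<open>a \<le> b\<close>])
      fix y assume y: "y \<in> {a..b}"
      have "(Complex x has_vector_derivative \<i>) (at y within {a..b})"
        unfolding Complex_eq[abs_def] by (auto intro!: derivative_eq_intros)
      from field_vector_diff_chain_at[of "Complex x" \<i>] this
      show "((\<lambda>y. F (Complex x y)) has_vector_derivative f (Complex x y) * \<i>) (at y within {a..b})"
        using field_vector_diff_chain_within[OF \<open>(Complex x has_vector_derivative \<i>) _\<close>
          has_field_derivative_at_within[OF F[OF S[OF x]]], of ] y
        by (auto simp: o_def mult.commute)
    qed
    then have "integral {a..b} (\<lambda>y. f (Complex x y) * \<i>) = F (Complex x b) - F (Complex x a)"
      by (rule integral_unique)
    then show ?thesis by (simp add: mult.commute)
  qed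
  have horiz: "norm (F (Complex q y) - F (Complex p y)) \<le> M * (q - p)"
    if y: "a \<le> y" "y \<le> b" "\<And>x. p \<le> x \<Longrightarrow> x \<le> q \<Longrightarrow> norm (f (Complex x y)) \<le> M" for y
  proof -
    let ?L = "closed_segment (Complex p y) (Complex q y)"
    have L: "\<exists>x. p \<le> x \<and> x \<le> q \<and> z = Complex x y" if z: "z \<in> ?L" for z
    proof -
      have "Re z \<in> closed_segment p q" "Im z = y"
        using z in_closed_segment_imp_Re_in_closed_segment[OF z]
          in_closed_segment_imp_Im_in_closed_segment[OF z] by auto
      then show ?thesis
        using \<open>p \<le> q\<close> by (intro exI[of _ "Re z"]) (auto simp: closed_segment_eq_real_ivl complex_eq_iff)
    qed
    have "norm (F (Complex q y) - F (Complex p y)) \<le> M * norm (Complex q y - Complex p y)"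
    proof (rule field_differentiable_bound[of ?L F f])
      fix z assume "z \<in> ?L"
      then obtain x where x: "p \<le> x" "x \<le> q" "z = Complex x y" using L by blast
      show "(F has_field_derivative f z) (at z within ?L)"
        unfolding x(3) by (rule has_field_derivative_at_within[OF F[OF S[OF x(1,2) y(1,2)]]])
      show "norm (f z) \<le> M" unfolding x(3) using y(3) x by blast
    qed auto
    then show ?thesis using \<open>p \<le> q\<close> by (simp add: cmod_def)
  qed
  let ?I = "\<lambda>x. integral {a..b} (\<lambda>y. f (Complex x y))"
  have "norm (?I q - ?I p) = norm (\<i> * ?I q - \<i> * ?I p)"
    by (simp add: norm_mult flip: right_diff_distrib)
  also have "\<dots> = norm ((F (Complex q b) - F (Complex p b)) - (F (Complex q a) - F (Complex p a)))"
    using assms by (simp add: vert algebra_simps)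
  also have "\<dots> \<le> M * (q - p) + M * (q - p)"
    using assms by (intro order_trans[OF norm_triangle_ineq4] add_mono horiz) auto
  finally show ?thesis by simp
qed

text \<open>The Gaussian weight makes the horizontal sides of the rectangle negligible, so that the lower
  bound on the line \<open>Re s = 3\<close> passes to the critical line.\<close>

lemma zeta_crit_first_moment_ge:
  obtains c T0 where "0 < c" "1 < T0"
    "\<And>T K. T0 \<le> T \<Longrightarrow> ln T \<le> K \<Longrightarrow> K \<le> T / 2 \<Longrightarrow>
       c * K / ln T \<le> integral {T - K..T + K} (\<lambda>t. norm (zeta_crit t))"
proof -
  obtain C where C: "1 \<le> C" "\<And>s. 1/2 \<le> Re s \<Longrightarrow> 1 \<le> Im s \<Longrightarrow> norm (zeta s) \<le> C * norm s"
    using zeta_norm_bound by blast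
  \<comment> \<open>In the strip 1/2 \<le> x \<le> 3 the weight exceeds its size on the line Re s =
    3 by at most exp((x - 3)^2/H^2), and |x - 3| \<le> 5/2, H \<ge> 1.\<close>
  define E :: real where "E = exp (25/4)"
  have E: "E > 0" by (simp add: E_def)
  \<comment> \<open>The left side is the total contribution of the horizontal sides: 5 is twice the
    width 5/2 of the strip, followed by the bounds for zeta and for the weight. The right side is
    half of the main term \<open>exp (-1) / 3 * H\<close> at H = 1.\<close>
  have "\<forall>\<^sub>F T in at_top. 5 * (C * (3 + 2 * T)) * (E * exp (- (ln T)\<^sup>2)) < exp (-1) / 6"
  proof (rule order_tendstoD)
    have "((\<lambda>T::real. (3 + 2 * T) * exp (- (ln T)\<^sup>2)) \<longlongrightarrow> 0) at_top" by real_asymp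
    from tendsto_mult_right_zero[OF this, of "5 * C * E"]
    have "((\<lambda>T. 5 * C * E * ((3 + 2 * T) * exp (- (ln T)\<^sup>2))) \<longlongrightarrow> 0) at_top" .
    also have "(\<lambda>T. 5 * C * E * ((3 + 2 * T) * exp (- (ln T)\<^sup>2))) =
      (\<lambda>T. 5 * (C * (3 + 2 * T)) * (E * exp (- (ln T)\<^sup>2)))"
      by (simp add: algebra_simps)
    finally show "((\<lambda>T. 5 * (C * (3 + 2 * T)) * (E * exp (- (ln T)\<^sup>2))) \<longlongrightarrow> 0) at_top" .
  qed auto
  then obtain T1 where T1: "\<And>T. T1 \<le> T \<Longrightarrow> 5 * (C * (3 + 2 * T)) * (E * exp (- (ln T)\<^sup>2)) < exp (-1) / 6"
    unfolding eventually_at_top_linorder by blast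
  show thesis
  proof
    show "0 < exp (-1) / (6 * E)" using E by simp
    show "1 < max T1 3" by simp
    fix T K assume T: "max T1 3 \<le> T" "ln T \<le> K" "K \<le> T / 2"
    \<comment> \<open>The half-length K is ln T standard widths H, so the weight at both ends is of
      order exp(-(ln T)^2), below every power of T. The price is the factor ln T in the final
      bound.\<close>
    define H where "H = K / ln T"
    have T3: "T \<ge> 3" using T by auto
    have lnT: "ln T \<ge> 1"
      using T3 exp_le by (subst ln_ge_iff) auto
    have H: "1 \<le> H" "H \<le> K" "K = H * ln T"
      using T lnT by (auto simp: H_def field_simps mult_le_cancel_left1)
    \<comment> \<open>The centre 3 + iT makes the weight real and positive on Re s = 3, as the lower
      bound for Re zeta requires there.\<close>
    define w where "w s = exp (((s - Complex 3 T) / of_real H)\<^sup>2)" for s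
    have norm_w: "norm (w (Complex x y)) = exp (((x - 3)\<^sup>2 - (y - T)\<^sup>2) / H\<^sup>2)" for x y
      by (simp add: w_def norm_exp_eq_Re power2_eq_square field_simps complex_diff
          Re_divide_of_real flip: of_real_mult)
    have w3: "w (Complex 3 y) = of_real (exp (- ((y - T) / H)\<^sup>2))" for y
      by (simp add: w_def exp_of_real[symmetric] complex_eq_iff Re_exp Im_exp power2_eq_square
          complex_diff Re_divide_of_real Im_divide_of_real flip: of_real_mult)
    have norm_w_le: "norm (w (Complex x y)) \<le> E * exp (- ((y - T) / H)\<^sup>2)" if "1/2 \<le> x" "x \<le> 3" for x y
    proof -
      have "(x - 3)\<^sup>2 / H\<^sup>2 \<le> (x - 3)\<^sup>2 / 1\<^sup>2"
        using H by (intro divide_left_mono power_mono) auto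
      also have "\<dots> \<le> 25/4"
        using abs_le_square_iff[of "x - 3" "5/2"] that by (auto simp: power2_eq_square)
      finally show ?thesis
        unfolding norm_w E_def exp_add[symmetric] exp_le_cancel_iff
        by (simp add: diff_divide_distrib[of "(x - 3)\<^sup>2"] power_divide)
    qed
    let ?f = "\<lambda>s. zeta s * w s" and ?S = "{s. 0 < Re s} \<inter> {s. 0 < Im s}"
    let ?I = "{T - K..T + K}"
    have cont_zeta: "continuous_on ?I (\<lambda>y. zeta (Complex x y))" if "1/2 \<le> x" for x
      using that T T3
      by (intro continuous_on_compose2[OF holomorphic_on_imp_continuous_on[OF holomorphic_zeta]])
         (auto simp: Complex_eq complex_eq_iff intro!: continuous_intros)
    have cont_w: "continuous_on ?I (\<lambda>y. w (Complex x y))" for x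
      using H unfolding w_def Complex_eq by (intro continuous_intros) auto
    \<comment> \<open>Only |y - T| \<le> H is kept, where the weight is at least exp(-1).\<close>
    have gauss: "2 * exp (-1) * H \<le> integral ?I (\<lambda>y. exp (- ((y - T) / H)\<^sup>2))"
    proof -
      have "2 * exp (-1) * H = integral {T - H..T + H} (\<lambda>y. exp (-1 :: real))"
        using H by simp
      also have "\<dots> \<le> integral {T - H..T + H} (\<lambda>y. exp (- ((y - T) / H)\<^sup>2))"
      proof (intro integral_le integrable_continuous_interval continuous_intros)
        fix y assume "y \<in> {T - H..T + H}"
        then have "\<bar>(y - T) / H\<bar> \<le> 1" using H by (auto simp: abs_le_iff field_simps)
        then show "exp (- 1) \<le> exp (- ((y - T) / H)\<^sup>2)" by (simp add: abs_square_le_1)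
      qed (use H in auto)
      also have "\<dots> \<le> integral ?I (\<lambda>y. exp (- ((y - T) / H)\<^sup>2))"
        by (intro integral_subset_le integrable_continuous_interval continuous_intros)
           (use H in auto)
      finally show ?thesis .
    qed
    have "exp (-1) / 3 * H \<le> (1/6) * integral ?I (\<lambda>y. exp (- ((y - T) / H)\<^sup>2))"
      using gauss by linarith
    also have "\<dots> = integral ?I (\<lambda>y. (1/6) * exp (- ((y - T) / H)\<^sup>2))"
      by (rule integral_mult_right[symmetric])
    also have "\<dots> \<le> integral ?I (\<lambda>y. Re (?f (Complex 3 y)))"
    proof (intro integral_le integrable_continuous_interval continuous_on_Re continuous_on_mult cont_zeta cont_w)
      fix y assume "y \<in> ?I"
      show "(1/6) * exp (- ((y - T) / H)\<^sup>2) \<le> Re (?f (Complex 3 y))"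
        unfolding w3 using Re_zeta_3_ge[of y] by (simp add: mult_right_mono)
    qed (use H in \<open>auto intro!: continuous_intros\<close>)
    also have "\<dots> = Re (integral ?I (\<lambda>y. ?f (Complex 3 y)))"
      using integral_linear[OF _ bounded_linear_Re, of "\<lambda>y. ?f (Complex 3 y)" ?I]
      by (simp add: o_def integrable_continuous_interval continuous_on_mult cont_zeta cont_w)
    also have "\<dots> \<le> norm (integral ?I (\<lambda>y. ?f (Complex 3 y)))" by (rule complex_Re_le_cmod)
    finally have right: "exp (-1) / 3 * H \<le> norm (integral ?I (\<lambda>y. ?f (Complex 3 y)))" .
    have "norm (integral ?I (\<lambda>y. ?f (Complex 3 y)) - integral ?I (\<lambda>y. ?f (Complex (1/2) y)))
       \<le> 2 * ((C * (3 + 2 * T)) * (E * exp (- (ln T)\<^sup>2))) * (3 - 1/2)"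
    proof (rule vertical_integrals_diff_le[where S = ?S])
      show "open ?S" "convex ?S"
        by (auto intro!: open_Int open_halfspace_Re_gt open_halfspace_Im_gt convex_Int
            convex_halfspace_Re_gt convex_halfspace_Im_gt)
      show "?f holomorphic_on ?S"
        unfolding w_def using H
        by (intro holomorphic_intros holomorphic_on_subset[OF holomorphic_zeta]) auto
      have bd: "norm (?f (Complex x y)) \<le> (C * (3 + 2 * T)) * (E * exp (- (ln T)\<^sup>2))"
        if x: "1/2 \<le> x" "x \<le> 3" and y: "\<bar>y - T\<bar> = K" for x y
      proof -
        have y1: "1 \<le> y" "y \<le> 2 * T" using y T T3 by (auto simp: abs_if split: if_splits)
        have "norm (zeta (Complex x y)) \<le> C * norm (Complex x y)" using x y1 by (intro C) auto
        also have "\<dots> \<le> C * (\<bar>x\<bar> + \<bar>y\<bar>)" using C cmod_le[of "Complex x y"] by simp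
        also have "\<dots> \<le> C * (3 + 2 * T)" using C x y1 by simp
        finally have z: "norm (zeta (Complex x y)) \<le> C * (3 + 2 * T)" .
        have "((y - T) / H)\<^sup>2 = (\<bar>y - T\<bar> / H)\<^sup>2" by (simp add: power_divide)
        also have "\<dots> = (ln T)\<^sup>2" unfolding y using H by simp
        finally have "norm (w (Complex x y)) \<le> E * exp (- (ln T)\<^sup>2)" using norm_w_le[OF x, of y] by simp
        with z show ?thesis unfolding norm_mult using C T3 E by (intro mult_mono) auto
      qed
      show "norm (?f (Complex x (T - K))) \<le> (C * (3 + 2 * T)) * (E * exp (- (ln T)\<^sup>2))"
           "norm (?f (Complex x (T + K))) \<le> (C * (3 + 2 * T)) * (E * exp (- (ln T)\<^sup>2))"
        if "1/2 \<le> x" "x \<le> 3" for x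
        using that H by (auto intro!: bd)
    qed (use T T3 H in auto)
    also have "\<dots> \<le> exp (-1) / 6" using T1[of T] T by (simp add: algebra_simps)
    also have "\<dots> \<le> exp (-1) / 6 * H" using H by (simp add: mult_le_cancel_left1)
    finally have "exp (-1) / 6 * H \<le> norm (integral ?I (\<lambda>y. ?f (Complex (1/2) y)))"
      using right norm_triangle_ineq2[of "integral ?I (\<lambda>y. ?f (Complex 3 y))"
        "integral ?I (\<lambda>y. ?f (Complex (1/2) y))"] by linarith
    also have "\<dots> \<le> integral ?I (\<lambda>y. norm (zeta_crit y) * E)"
    proof (rule integral_norm_bound_integral)
      fix y
      have "E * exp (- ((y - T) / H)\<^sup>2) \<le> E * 1" using E by (intro mult_left_mono) auto
      then have "norm (w (Complex (1/2) y)) \<le> E"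
        using norm_w_le[of "1/2" y] by simp
      then show "norm (?f (Complex (1/2) y)) \<le> norm (zeta_crit y) * E"
        unfolding norm_mult by (intro mult_left_mono) auto
    qed (auto intro!: integrable_continuous_interval continuous_intros cont_zeta cont_w)
    also have "\<dots> = integral ?I (\<lambda>y. norm (zeta_crit y)) * E" by (rule integral_mult_left)
    finally have "exp (-1) / 6 * H / E \<le> integral ?I (\<lambda>y. norm (zeta_crit y))"
      using E by (simp add: pos_divide_le_eq)
    then show "exp (-1) / (6 * E) * K / ln T \<le> integral ?I (\<lambda>y. norm (zeta_crit y))"
      by (simp add: H_def mult_ac)
  qed
qed

lemma zeta_crit_second_moment_ge:
  obtains c T0 where "0 < c" "1 < T0"
    "\<And>T K. T0 \<le> T \<Longrightarrow> ln T \<le> K \<Longrightarrow> K \<le> T / 2 \<Longrightarrow>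
       c * K / (ln T)\<^sup>2 \<le> integral {T - K..T + K} (\<lambda>t. (norm (zeta_crit t))\<^sup>2)"
proof -
  obtain c T0 where c: "0 < c" "1 < T0"
    and le: "\<And>T K. T0 \<le> T \<Longrightarrow> ln T \<le> K \<Longrightarrow> K \<le> T / 2 \<Longrightarrow>
       c * K / ln T \<le> integral {T - K..T + K} (\<lambda>t. norm (zeta_crit t))"
    using zeta_crit_first_moment_ge by blast
  show thesis
  proof
    show "0 < c\<^sup>2 / 2" "1 < T0" using c by auto
    fix T K assume T: "T0 \<le> T" "ln T \<le> K" "K \<le> T / 2"
    \<comment> \<open>The inequality |z| \<le> \<eta>/2 + |z|^2/(2\<eta>) replaces Cauchy-Schwarz.
      This \<eta> is the optimal choice: the constant part then consumes exactly half of the first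
      moment bound.\<close>
    define \<eta> where "\<eta> = c / (2 * ln T)"
    have lnT: "0 < ln T" using c T by simp
    have \<eta>: "\<eta> > 0" using c lnT by (simp add: \<eta>_def)
    let ?I = "{T - K..T + K}"
    have int: "(\<lambda>t. (norm (zeta_crit t))\<^sup>2) integrable_on ?I"
      by (intro integrable_continuous_interval continuous_intros continuous_on_zeta_crit)
    have "c * K / ln T \<le> integral ?I (\<lambda>t. norm (zeta_crit t))" by (rule le[OF T])
    also have "\<dots> \<le> integral ?I (\<lambda>t. \<eta> / 2 + (norm (zeta_crit t))\<^sup>2 / (2 * \<eta>))"
    proof (intro integral_le integrable_continuous_interval continuous_intros continuous_on_zeta_crit)
      fix t
      have "0 \<le> (norm (zeta_crit t) - \<eta>)\<^sup>2" by simp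
      then show "norm (zeta_crit t) \<le> \<eta> / 2 + (norm (zeta_crit t))\<^sup>2 / (2 * \<eta>)"
        using \<eta> by (simp add: power2_eq_square field_simps)
    qed (use \<eta> in auto)
    also have "\<dots> = \<eta> * K + integral ?I (\<lambda>t. (norm (zeta_crit t))\<^sup>2) / (2 * \<eta>)"
      using lnT T by (subst integral_add) (use \<eta> in \<open>auto intro!: integrable_continuous_interval continuous_intros continuous_on_zeta_crit\<close>)
    finally have "c * K / ln T - \<eta> * K \<le> integral ?I (\<lambda>t. (norm (zeta_crit t))\<^sup>2) / (2 * \<eta>)" by simp
    then have "(c * K / ln T - \<eta> * K) * (2 * \<eta>) \<le> integral ?I (\<lambda>t. (norm (zeta_crit t))\<^sup>2)"
      using \<eta> by (simp add: pos_le_divide_eq)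
    also have "(c * K / ln T - \<eta> * K) * (2 * \<eta>) = c\<^sup>2 / 2 * K / (ln T)\<^sup>2"
      using lnT by (simp add: \<eta>_def field_simps power2_eq_square)
    finally show "c\<^sup>2 / 2 * K / (ln T)\<^sup>2 \<le> integral ?I (\<lambda>t. (norm (zeta_crit t))\<^sup>2)" .
  qed
qed

section \<open>Monotonicity and growth of the ladder\<close>

lemma continuous_on_hardy_Z: "continuous_on A hardy_Z"
proof -
  have "continuous_on A (\<lambda>t. ln_Gamma (Complex (1/4) (t/2)))"
    unfolding Complex_eq
    by (intro continuous_on_compose2[OF holomorphic_on_imp_continuous_on[OF holomorphic_ln_Gamma[of "- \<real>\<^sub>\<le>\<^sub>0"]]]
          continuous_intros) (auto simp: complex_nonpos_Reals_iff)
  then have "continuous_on A siegel_theta"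
    unfolding siegel_theta_def[abs_def] by (intro continuous_intros) auto
  then show ?thesis
    unfolding hardy_Z_def[abs_def] cis_conv_exp
    by (intro continuous_intros continuous_on_zeta_crit)
qed

text \<open>Both sides of the ladder equation are nondecreasing, the left one in x because both
  \<open>\<mu>\<close> and the weight exp(-2t/x) grow. If \<phi> decreased from S to T, the two
  sides would be squeezed to equality and \<phi> S would be a second solution at T, against
  uniqueness.\<close>

lemma ladder_solution_mono_on:
  assumes \<mu>: "ladder_weight y0 \<mu>" and \<phi>: "ladder_solution y0 \<mu> T0 \<phi>"
  shows "mono_on {T0..} \<phi>"
proof (rule mono_onI)
  fix S T assume ST: "S \<in> {T0..}" "T \<in> {T0..}" "S \<le> T"
  have y0: "0 < y0" and mono: "mono_on {y0..} \<mu>" using \<mu> by (auto simp: ladder_weight_def)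
  define F where "F T = integral {0..T} (\<lambda>t. (hardy_Z t)\<^sup>2)" for T
  define G where "G x = integral {0..\<mu> x} (\<lambda>t. (hardy_Z t)\<^sup>2 * exp (- 2 * t / x))" for x
  have F_mono: "F S \<le> F T"
    unfolding F_def using ST
    by (intro integral_subset_le integrable_continuous_interval continuous_intros continuous_on_hardy_Z) auto
  have G_mono: "G x \<le> G y" if xy: "y0 \<le> x" "x \<le> y" for x y
  proof -
    have "G x \<le> integral {0..\<mu> x} (\<lambda>t. (hardy_Z t)\<^sup>2 * exp (- 2 * t / y))"
      unfolding G_def
    proof (intro integral_le integrable_continuous_interval continuous_intros continuous_on_hardy_Z)
      fix t assume "t \<in> {0..\<mu> x}"
      then have "2 * t / y \<le> 2 * t / x" using xy y0 by (intro divide_left_mono) auto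
      then show "(hardy_Z t)\<^sup>2 * exp (- 2 * t / x) \<le> (hardy_Z t)\<^sup>2 * exp (- 2 * t / y)"
        by (intro mult_left_mono) auto
    qed (use xy y0 in auto)
    also have "\<dots> \<le> G y"
      unfolding G_def using xy y0 mono_onD[OF mono, of x y]
      by (intro integral_subset_le integrable_continuous_interval continuous_intros continuous_on_hardy_Z) auto
    finally show ?thesis .
  qed
  have sol: "ladder_equation \<mu> R x \<longleftrightarrow> G x = F R" for R x
    by (simp add: ladder_equation_def G_def F_def)
  have unique: "y0 \<le> \<phi> R" "G (\<phi> R) = F R" "\<And>x. y0 \<le> x \<Longrightarrow> G x = F R \<Longrightarrow> x = \<phi> R" if "R \<ge> T0" for R
    using \<phi> that unfolding ladder_solution_def sol by blast+
  show "\<phi> S \<le> \<phi> T"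
  proof (rule ccontr)
    assume "\<not> \<phi> S \<le> \<phi> T"
    moreover have ST': "T0 \<le> S" "T0 \<le> T" using ST by auto
    ultimately have "G (\<phi> T) \<le> G (\<phi> S)" using unique(1)[OF ST'(2)] by (intro G_mono) auto
    then have "G (\<phi> S) = F T"
      using F_mono unique(2)[OF ST'(1)] unique(2)[OF ST'(2)] by linarith
    then have "\<phi> S = \<phi> T" using unique(1)[OF ST'(1)] unique(3)[OF ST'(2)] by blast
    with \<open>\<not> \<phi> S \<le> \<phi> T\<close> show False by simp
  qed
qed

lemma tendsto_omega_div_ln:
  assumes "(\<lambda>t. \<omega> t / ln t - 1) \<in> O(\<lambda>t. ln (ln t) / ln t)"
  shows "((\<lambda>t::real. \<omega> t / ln t) \<longlongrightarrow> (1::real)) at_top"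
proof -
  have "(\<lambda>t::real. ln (ln t) / ln t) \<in> o(\<lambda>_. 1::real)" by real_asymp
  with assms have "(\<lambda>t. \<omega> t / ln t - 1) \<in> o(\<lambda>_. 1)"
    by (rule landau_o.big_small_trans)
  then have "((\<lambda>t. \<omega> t / ln t - 1) \<longlongrightarrow> 0) at_top"
    using smalloD_tendsto by fastforce
  from tendsto_add[OF this tendsto_const[of 1]] show ?thesis by simp
qed

text \<open>What the analytic estimates require of the ladder, with the eventual statements turned
  into pointwise ones beyond a single threshold. The choice T1 \<ge> e gives ln t \<ge> 1 and so a
  positive \<omega>.\<close>

locale zeta_ladder =
  fixes T1 :: real and \<phi>1 \<omega> :: "real \<Rightarrow> real"
  assumes T1: "exp 1 \<le> T1"
    and deriv: "\<And>t. T1 \<le> t \<Longrightarrow> (\<phi>1 has_real_derivative (norm (zeta_crit t))\<^sup>2 / \<omega> t) (at t)"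
    and omega_ge: "\<And>t. T1 \<le> t \<Longrightarrow> ln t / 2 \<le> \<omega> t"
    and omega_le: "\<And>t. T1 \<le> t \<Longrightarrow> \<omega> t \<le> 2 * ln t"
begin

lemma ln_ge_1: "T1 \<le> t \<Longrightarrow> 1 \<le> ln t"
  using T1 ln_ge_iff[of t 1] less_le_trans[OF exp_gt_zero[of 1], of t] by linarith

lemma omega_pos: "T1 \<le> t \<Longrightarrow> 0 < \<omega> t"
  using omega_ge[of t] ln_ge_1[of t] by linarith

lemma T1_pos: "0 < T1"
  using T1 less_le_trans[OF exp_gt_zero[of 1]] by blast

lemma continuous_on_phi1: "continuous_on {T1..} \<phi>1"
  using deriv by (intro continuous_at_imp_continuous_on) (auto intro: DERIV_isCont)

text \<open>The derivative is nonnegative but has zeros. Equal values at two points would make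
  \<phi>1 constant in between, hence zeta zero on an interval of the critical line.\<close>

lemma strict_mono_on_phi1: "strict_mono_on {T1..} \<phi>1"
proof (rule strict_mono_onI)
  have mono: "\<phi>1 a \<le> \<phi>1 b" if "T1 \<le> a" "a \<le> b" for a b
  proof (rule DERIV_nonneg_imp_nondecreasing[OF that(2)])
    fix x assume "a \<le> x" "x \<le> b"
    then show "\<exists>y. (\<phi>1 has_real_derivative y) (at x) \<and> 0 \<le> y"
      using deriv[of x] omega_pos[of x] that by (intro exI conjI) (auto intro!: divide_nonneg_nonneg)
  qed
  fix a b assume ab: "a \<in> {T1..}" "b \<in> {T1..}" "a < b"
  show "\<phi>1 a < \<phi>1 b"
  proof (rule ccontr)
    assume neg: "\<not> \<phi>1 a < \<phi>1 b"
    have const: "\<phi>1 x = \<phi>1 a" if "a < x" "x < b" for x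
      using mono[of a x] mono[of x b] neg that ab by auto
    obtain t where t: "a < t" "t < b" "zeta_crit t \<noteq> 0"
      using zeta_crit_not_zero_on_interval[of a b] ab T1_pos by auto
    have "((\<lambda>_. \<phi>1 a) has_real_derivative (norm (zeta_crit t))\<^sup>2 / \<omega> t) (at t)"
      by (rule has_field_derivative_transform_within_open[OF deriv[of t], of "{a<..<b}"])
         (use t ab const in auto)
    then have "(norm (zeta_crit t))\<^sup>2 / \<omega> t = 0"
      using DERIV_unique[OF _ DERIV_const] by blast
    then show False using t omega_pos[of t] ab by auto
  qed
qed

text \<open>Two logarithms are lost in the second moment and one in dividing by \<omega>; halving
  the exponent absorbs all three and the constant.\<close>

lemma phi1_growth:
  assumes \<delta>: "0 < \<delta>" "\<delta> \<le> 1"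
  shows "\<forall>\<^sub>F t in at_top. \<phi>1 t + t powr (\<delta> / 2) \<le> \<phi>1 (t + t powr \<delta>)"
proof -
  obtain c T0 where c: "0 < c" "1 < T0"
    "\<And>T K. T0 \<le> T \<Longrightarrow> ln T \<le> K \<Longrightarrow> K \<le> T / 2 \<Longrightarrow>
       c * K / (ln T)\<^sup>2 \<le> integral {T - K..T + K} (\<lambda>t. (norm (zeta_crit t))\<^sup>2)"
    using zeta_crit_second_moment_ge by blast
  have "\<forall>\<^sub>F t in at_top. ln (2 * t) \<le> t powr \<delta> / 2"
    using \<delta> by real_asymp
  moreover have "\<forall>\<^sub>F t in at_top. 1 \<le> c * t powr (\<delta> / 2) / (4 * ln (2 * t) ^ 3)"
  proof -
    have "filterlim (\<lambda>t. c * t powr (\<delta> / 2) / (4 * ln (2 * t) ^ 3)) at_top at_top"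
      using \<delta> c by real_asymp
    then show ?thesis by (simp add: filterlim_at_top)
  qed
  moreover have "\<forall>\<^sub>F t in at_top. max T0 T1 \<le> t" by (rule eventually_ge_at_top)
  ultimately show ?thesis
  proof eventually_elim
    case (elim t)
    \<comment> \<open>The moment bound is stated for intervals symmetric about T. Since \<delta>
      \<le> 1, the interval ends before 2t and ln(2t) bounds every logarithm that occurs.\<close>
    define K T where "K = t powr \<delta> / 2" and "T = t + K"
    have t1: "1 < t" using elim c by simp
    have "t powr \<delta> \<le> t powr 1" using \<delta> t1 by (intro powr_mono) auto
    then have K: "0 < K" "2 * K \<le> t" using t1 by (auto simp: K_def)
    have t2: "1 < 2 * t" using t1 by simp
    have l1: "1 \<le> ln t" using ln_ge_1 elim by auto
    have l2: "ln T \<le> ln (2 * t)" "ln t \<le> ln T" "ln (t + 2 * K) \<le> ln (2 * t)"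
      using K t1 by (auto simp: T_def)
    let ?I = "{t..t + 2 * K}"
    have "c * K / (ln (2 * t))\<^sup>2 \<le> c * K / (ln T)\<^sup>2"
      using l1 l2 c K t2 by (intro divide_left_mono power_mono mult_pos_pos mult_nonneg_nonneg zero_less_power) auto
    also have "\<dots> \<le> integral {T - K..T + K} (\<lambda>t. (norm (zeta_crit t))\<^sup>2)"
      using elim K order_trans[OF l2(1)] by (intro c(3)) (use l2 in \<open>auto simp: T_def K_def[symmetric]\<close>)
    also have "{T - K..T + K} = ?I" by (auto simp: T_def)
    finally have I: "c * K / (ln (2 * t))\<^sup>2 \<le> integral ?I (\<lambda>t. (norm (zeta_crit t))\<^sup>2)" .
    have I1: "((\<lambda>u. (norm (zeta_crit u))\<^sup>2 / \<omega> u) has_integral \<phi>1 (t + 2 * K) - \<phi>1 t) ?I"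
    proof (rule fundamental_theorem_of_calculus)
      fix u assume "u \<in> ?I"
      then show "(\<phi>1 has_vector_derivative (norm (zeta_crit u))\<^sup>2 / \<omega> u) (at u within ?I)"
        using deriv[of u] elim
        by (auto simp flip: has_real_derivative_iff_has_vector_derivative intro: has_field_derivative_at_within)
    qed (use K in auto)
    have I2: "((\<lambda>u. (norm (zeta_crit u))\<^sup>2 / (2 * ln (2 * t))) has_integral
        integral ?I (\<lambda>u. (norm (zeta_crit u))\<^sup>2) / (2 * ln (2 * t))) ?I"
      by (intro has_integral_divide integrable_integral integrable_continuous_interval
          continuous_intros continuous_on_zeta_crit)
    have I3: "(norm (zeta_crit u))\<^sup>2 / (2 * ln (2 * t)) \<le> (norm (zeta_crit u))\<^sup>2 / \<omega> u" if "u \<in> ?I" for u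
    proof -
      have "ln u \<le> ln (2 * t)" using that K t1 by auto
      then have "\<omega> u \<le> 2 * ln (2 * t)" using omega_le[of u] that elim by auto
      then show ?thesis using omega_pos[of u] that elim
        by (intro divide_left_mono mult_pos_pos) auto
    qed
    have "integral ?I (\<lambda>u. (norm (zeta_crit u))\<^sup>2) / (2 * ln (2 * t)) \<le> \<phi>1 (t + 2 * K) - \<phi>1 t"
      by (rule has_integral_le[OF I2 I1 I3])
    moreover have "c * K / (ln (2 * t))\<^sup>2 / (2 * ln (2 * t)) \<le> integral ?I (\<lambda>u. (norm (zeta_crit u))\<^sup>2) / (2 * ln (2 * t))"
      using I l1 l2 by (intro divide_right_mono) auto
    moreover have "t powr (\<delta> / 2) \<le> c * K / (ln (2 * t))\<^sup>2 / (2 * ln (2 * t))"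
    proof -
      have "t powr (\<delta> / 2) * 1 \<le> t powr (\<delta> / 2) * (c * t powr (\<delta> / 2) / (4 * ln (2 * t) ^ 3))"
        using elim by (intro mult_left_mono) auto
      also have "\<dots> = c * (t powr (\<delta> / 2) * t powr (\<delta> / 2)) / (4 * ln (2 * t) ^ 3)"
        by (simp add: mult_ac)
      also have "t powr (\<delta> / 2) * t powr (\<delta> / 2) = t powr \<delta>"
        by (simp flip: powr_add)
      also have "c * t powr \<delta> / (4 * ln (2 * t) ^ 3) = c * K / (ln (2 * t))\<^sup>2 / (2 * ln (2 * t))"
        by (simp add: K_def power2_eq_square power3_eq_cube)
      finally show ?thesis by simp
    qed
    ultimately show ?case by (simp add: K_def)
  qed
qed

text \<open>The linear bound for zeta makes the derivative at most quadratic, so \<phi>1 grows at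
  most cubically; the fourth power swallows the constants.\<close>

lemma phi1_le_power4: "\<forall>\<^sub>F t in at_top. \<phi>1 t \<le> t ^ 4"
proof -
  obtain C where C: "1 \<le> C" "\<And>s. 1/2 \<le> Re s \<Longrightarrow> 1 \<le> Im s \<Longrightarrow> norm (zeta s) \<le> C * norm s"
    using zeta_norm_bound by blast
  define B where "B = \<phi>1 T1 - 2 * C\<^sup>2 * (1 + T1)^3"
  have "\<phi>1 t - 2 * C\<^sup>2 * (1 + t)^3 \<le> B" if "T1 \<le> t" for t
    unfolding B_def
  proof (rule DERIV_nonpos_imp_nonincreasing[OF that])
    fix x assume x: "T1 \<le> x" "x \<le> t"
    have x1: "1 \<le> x" using x T1 exp_ge_add_one_self[of 1] by linarith
    have "norm (zeta_crit x) \<le> C * norm (Complex (1/2) x)" using x1 by (intro C) auto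
    also have "\<dots> \<le> C * (1 + x)" using C x1 cmod_le[of "Complex (1/2) x"] by (intro mult_left_mono) auto
    finally have "(norm (zeta_crit x))\<^sup>2 \<le> (C * (1 + x))\<^sup>2" by (intro power_mono) auto
    moreover have "1/2 \<le> \<omega> x" using omega_ge[of x] ln_ge_1[of x] x by auto
    ultimately have "(norm (zeta_crit x))\<^sup>2 / \<omega> x \<le> (C * (1 + x))\<^sup>2 / (1/2)"
      by (intro frac_le) auto
    also have "\<dots> \<le> 2 * C\<^sup>2 * (3 * (1 + x)\<^sup>2)" by (simp add: power_mult_distrib)
    finally have "(norm (zeta_crit x))\<^sup>2 / \<omega> x - 2 * C\<^sup>2 * (3 * (1 + x)\<^sup>2) \<le> 0" by simp
    moreover have "((\<lambda>t. \<phi>1 t - 2 * C\<^sup>2 * (1 + t)^3) has_real_derivative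
       (norm (zeta_crit x))\<^sup>2 / \<omega> x - 2 * C\<^sup>2 * (3 * (1 + x)\<^sup>2)) (at x)"
      by (rule DERIV_diff[OF deriv[OF x(1)]]) (auto intro!: derivative_eq_intros)
    ultimately show "\<exists>y. ((\<lambda>t. \<phi>1 t - 2 * C\<^sup>2 * (1 + t)^3) has_real_derivative y) (at x) \<and> y \<le> 0"
      by blast
  qed
  then have "\<forall>\<^sub>F t in at_top. \<phi>1 t \<le> B + 2 * C\<^sup>2 * (1 + t)^3"
    by (intro eventually_at_top_linorderI[of T1]) (smt (verit))
  moreover have "\<forall>\<^sub>F t in at_top. B + 2 * C\<^sup>2 * (1 + t)^3 \<le> t ^ 4" by real_asymp
  ultimately show ?thesis by eventually_elim linarith
qed

end

section \<open>Iterated preimages\<close>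

text \<open>Here zeta disappears: the study of preimages uses only monotonicity and growth. The
  domain of the ladder starts at T0, the quantitative information at T1.\<close>

locale growing_ladder =
  fixes T0 T1 :: real and \<phi>1 :: "real \<Rightarrow> real"
  assumes T01: "T0 \<le> T1" "0 < T1"
    and mono: "mono_on {T0..} \<phi>1"
    and strict: "strict_mono_on {T1..} \<phi>1"
    and cont: "continuous_on {T1..} \<phi>1"
    and growth: "\<And>\<delta>. 0 < \<delta> \<Longrightarrow> \<delta> \<le> 1 \<Longrightarrow>
       \<forall>\<^sub>F t in at_top. \<phi>1 t + t powr (\<delta> / 2) \<le> \<phi>1 (t + t powr \<delta>)"
    and le_power4: "\<forall>\<^sub>F t in at_top. \<phi>1 t \<le> t ^ 4"
begin

definition inverse_step :: "real \<Rightarrow> real" where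
  "inverse_step = the_inv_into {T1..} \<phi>1"

text \<open>Unboundedness comes from the growth property with \<delta> = 1, which says that \<phi>1
  increases by at least the square root of t between t and 2t.\<close>

lemma filterlim_phi1: "filterlim \<phi>1 at_top at_top"
proof (rule filterlim_at_top_mono)
  show "filterlim (\<lambda>t. \<phi>1 T1 + (t / 2) powr (1/2)) at_top at_top" by real_asymp
  have "\<forall>\<^sub>F t in at_top. \<phi>1 T1 + t powr (1/2) \<le> \<phi>1 (t + t)"
    using growth[OF zero_less_one order.refl] eventually_ge_at_top[of T1]
  proof eventually_elim
    case (elim t)
    then show ?case using mono_onD[OF mono, of T1 t] T01 by simp
  qed
  moreover have "filterlim (\<lambda>t::real. t / 2) at_top at_top" by real_asymp
  ultimately have "\<forall>\<^sub>F t in at_top. \<phi>1 T1 + (t / 2) powr (1/2) \<le> \<phi>1 (t / 2 + t / 2)"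
    by (rule eventually_compose_filterlim)
  then show "\<forall>\<^sub>F t in at_top. \<phi>1 T1 + (t / 2) powr (1/2) \<le> \<phi>1 t" by simp
qed

lemma inverse_step:
  assumes "\<phi>1 T1 \<le> T"
  shows "T1 \<le> inverse_step T" "\<phi>1 (inverse_step T) = T"
proof -
  have "\<forall>\<^sub>F b in at_top. T1 \<le> b \<and> T \<le> \<phi>1 b"
    using filterlim_phi1 by (auto simp: filterlim_at_top intro!: eventually_conj eventually_ge_at_top)
  then obtain b where b: "T1 \<le> b" "T \<le> \<phi>1 b"
    by (auto dest!: eventually_happens'[rotated])
  obtain x where x: "T1 \<le> x" "x \<le> b" "\<phi>1 x = T"
    using IVT'[of \<phi>1 T1 T b] assms b continuous_on_subset[OF cont, of "{T1..b}"] by auto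
  have "inj_on \<phi>1 {T1..}" by (rule strict_mono_on_imp_inj_on[OF strict])
  with x have "inverse_step T = x"
    unfolding inverse_step_def by (metis atLeast_iff the_inv_into_f_f)
  with x show "T1 \<le> inverse_step T" "\<phi>1 (inverse_step T) = T" by auto
qed

text \<open>By monotonicity a point between T0 and T1 has a value at most \<open>\<phi>1 T1\<close>,
  so every solution lies beyond T1, where \<phi>1 is injective.\<close>

lemma inverse_step_unique:
  assumes "\<phi>1 T1 < T" "T0 \<le> x" "\<phi>1 x = T"
  shows "x = inverse_step T"
proof -
  have "T1 \<le> x" using mono_onD[OF mono, of x T1] assms T01 by fastforce
  then show ?thesis
    using inverse_step[of T] assms strict_mono_on_imp_inj_on[OF strict] by (auto dest!: inj_onD)
qed

lemma less_inverse_step_iff: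
  "\<phi>1 T1 \<le> T \<Longrightarrow> T1 \<le> x \<Longrightarrow> x < inverse_step T \<longleftrightarrow> \<phi>1 x < T"
  using inverse_step[of T] strict_mono_on_less[OF strict, of x "inverse_step T"] by simp

lemma filterlim_inverse_step: "filterlim inverse_step at_top at_top"
  unfolding filterlim_at_top_dense
proof
  fix M
  have "\<forall>\<^sub>F T in at_top. \<phi>1 (max M T1) < T" by (rule eventually_gt_at_top)
  then show "\<forall>\<^sub>F T in at_top. M < inverse_step T"
  proof eventually_elim
    case (elim T)
    then show ?case
      using less_inverse_step_iff[of T "max M T1"] mono_onD[OF mono, of T1 "max M T1"] T01 by auto
  qed
qed

lemma filterlim_inverse_step_pow: "filterlim (inverse_step ^^ r) at_top at_top"
proof (induction r)
  case 0
  then show ?case by (simp add: filterlim_ident id_def)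
next
  case (Suc r)
  show ?case using filterlim_compose[OF filterlim_inverse_step Suc] by (simp add: o_def)
qed

text \<open>Exceeding T1 places a backward iterate where \<phi>1 is strictly increasing; exceeding
  \<open>\<phi>1 T1\<close> makes one more step back possible and unique.\<close>

definition regular :: "nat \<Rightarrow> real \<Rightarrow> bool" where
  "regular r T \<longleftrightarrow> (\<forall>j\<le>r. max T1 (\<phi>1 T1) < (inverse_step ^^ j) T)"

lemma eventually_regular: "\<forall>\<^sub>F T in at_top. regular r T"
proof -
  have "\<forall>\<^sub>F T in at_top. \<forall>j\<in>{..r}. max T1 (\<phi>1 T1) < (inverse_step ^^ j) T"
    using filterlim_inverse_step_pow unfolding filterlim_at_top_dense
    by (intro eventually_ball_finite) blast+
  then show ?thesis by (simp add: regular_def Ball_def)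
qed

lemma phi1_pow_inverse_step_pow:
  "regular r T \<Longrightarrow> j \<le> r \<Longrightarrow> (\<phi>1 ^^ j) ((inverse_step ^^ r) T) = (inverse_step ^^ (r - j)) T"
proof (induction j)
  case (Suc j)
  then obtain m where m: "r - j = Suc m" "r - Suc j = m" by (metis Suc_diff_Suc Suc_le_eq)
  have "m \<le> r" using m by linarith
  then have "\<phi>1 T1 \<le> (inverse_step ^^ m) T" using Suc.prems unfolding regular_def by auto
  moreover have IH: "(\<phi>1 ^^ j) ((inverse_step ^^ r) T) = (inverse_step ^^ Suc m) T"
    using Suc.IH Suc.prems unfolding m by linarith
  ultimately show ?case unfolding m funpow.simps(2) o_apply IH by (intro inverse_step(2))
qed simp

text \<open>For uniqueness, a candidate x is followed back from its last iterate T: each earlier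
  iterate is at least T0 and therefore forced by \<open>inverse_step_unique\<close>.\<close>

lemma ladder_preimage_eq:
  assumes "regular r T"
  shows "ladder_preimage T0 \<phi>1 r T = (inverse_step ^^ r) T"
  unfolding ladder_preimage_def the_inv_into_def
proof (rule the_equality)
  have "max T1 (\<phi>1 T1) < (inverse_step ^^ (r - j)) T" for j
    using assms unfolding regular_def by simp
  then have "T0 \<le> (inverse_step ^^ (r - j)) T" for j
    using T01 by (meson less_imp_le max.strict_boundedE order_trans)
  then show "(inverse_step ^^ r) T \<in> {x. \<forall>j<r. T0 \<le> (\<phi>1 ^^ j) x} \<and>
      (\<phi>1 ^^ r) ((inverse_step ^^ r) T) = T"
    using phi1_pow_inverse_step_pow[OF assms] by simp
next
  fix x assume "x \<in> {x. \<forall>j<r. T0 \<le> (\<phi>1 ^^ j) x} \<and> (\<phi>1 ^^ r) x = T"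
  then have x: "\<forall>j<r. T0 \<le> (\<phi>1 ^^ j) x" "(\<phi>1 ^^ r) x = T" by auto
  have "(\<phi>1 ^^ (r - j)) x = (inverse_step ^^ j) T" if "j \<le> r" for j
    using that
  proof (induction j)
    case (Suc j)
    then obtain m where m: "r - j = Suc m" "r - Suc j = m" by (metis Suc_diff_Suc Suc_le_eq)
    have "m < r" using m by linarith
    have "\<phi>1 ((\<phi>1 ^^ m) x) = (inverse_step ^^ j) T" using Suc m by simp
    moreover have "\<phi>1 T1 < (inverse_step ^^ j) T" using assms Suc.prems unfolding regular_def by auto
    ultimately show ?case
      using inverse_step_unique x(1) \<open>m < r\<close> m by simp
  qed (use x in simp)
  from this[of r] show "x = (inverse_step ^^ r) T" by simp
qed

text \<open>For j = k this places the associated point of index 0 strictly between S and T.\<close>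

lemma between_preimages:
  assumes reg: "regular k S" "regular k T"
    and d: "(inverse_step ^^ k) S < d" "d < (inverse_step ^^ k) T" and "j \<le> k"
  shows "(inverse_step ^^ (k - j)) S < (\<phi>1 ^^ j) d \<and> (\<phi>1 ^^ j) d < (inverse_step ^^ (k - j)) T"
  using \<open>j \<le> k\<close>
proof (induction j)
  case (Suc j)
  then obtain m where m: "k - j = Suc m" "k - Suc j = m" by (metis Suc_diff_Suc Suc_le_eq)
  have IH: "(inverse_step ^^ Suc m) S < (\<phi>1 ^^ j) d" "(\<phi>1 ^^ j) d < (inverse_step ^^ Suc m) T"
    using Suc unfolding m by auto
  have "m \<le> k" "Suc m \<le> k" using m by linarith+
  then have "T1 < (inverse_step ^^ Suc m) S" "\<phi>1 T1 < (inverse_step ^^ m) S" "\<phi>1 T1 < (inverse_step ^^ m) T"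
    using reg unfolding regular_def by (meson max.strict_boundedE)+
  moreover from this have "\<phi>1 ((inverse_step ^^ Suc m) S) = (inverse_step ^^ m) S"
     "\<phi>1 ((inverse_step ^^ Suc m) T) = (inverse_step ^^ m) T"
    using inverse_step(2) by auto
  ultimately show ?case
    using IH strict_mono_onD[OF strict, of "(inverse_step ^^ Suc m) S" "(\<phi>1 ^^ j) d"]
      strict_mono_onD[OF strict, of "(\<phi>1 ^^ j) d" "(inverse_step ^^ Suc m) T"]
    unfolding m by simp
qed (use d in simp)

text \<open>The exponent drops to \<open>\<delta> / 8\<close> because the ladder at \<open>x\<close> is at most \<open>x ^ 4\<close> and an interval of
  length \<open>x powr \<delta>\<close> is only known to be mapped onto one of length \<open>x powr (\<delta> / 2)\<close>.\<close>

lemma preimage_gap: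
  assumes "0 < \<delta>" "\<delta> \<le> 1"
  shows "\<forall>\<^sub>F T in at_top. (inverse_step ^^ r) (T + U) \<le> (inverse_step ^^ r) T + ((inverse_step ^^ r) T) powr \<delta>"
  using assms
proof (induction r arbitrary: \<delta>)
  case 0
  have "filterlim (\<lambda>T. T powr \<delta>) at_top at_top" using 0 by real_asymp
  then show ?case by (simp add: filterlim_at_top)
next
  case (Suc r)
  let ?p = "\<lambda>T. (inverse_step ^^ Suc r) T"
  have "\<forall>\<^sub>F T in at_top. \<phi>1 (?p T) + ?p T powr (\<delta> / 2) \<le> \<phi>1 (?p T + ?p T powr \<delta>)"
    using growth[OF Suc.prems] filterlim_inverse_step_pow by (rule eventually_compose_filterlim)
  moreover have "\<forall>\<^sub>F T in at_top. \<phi>1 (?p T) \<le> ?p T ^ 4"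
    using le_power4 filterlim_inverse_step_pow by (rule eventually_compose_filterlim)
  moreover have "\<forall>\<^sub>F T in at_top. (inverse_step ^^ r) (T + U) \<le>
     (inverse_step ^^ r) T + ((inverse_step ^^ r) T) powr (\<delta> / 8)"
    using Suc by auto
  moreover have "\<forall>\<^sub>F T in at_top. regular (Suc r) (T + U)"
    by (rule eventually_compose_filterlim[OF eventually_regular]) real_asymp
  moreover note eventually_regular[of "Suc r"]
  ultimately show ?case
  proof eventually_elim
    case (elim T)
    define a where "a = (inverse_step ^^ r) T"
    define b where "b = (inverse_step ^^ r) (T + U)"
    define x where "x = inverse_step a"
    have px: "?p T = x" "?p (T + U) = inverse_step b" by (simp_all add: x_def a_def b_def)
    have ab: "\<phi>1 T1 < a" "\<phi>1 T1 < b" "T1 < a" using elim(4,5) unfolding regular_def a_def b_def by auto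
    have x: "T1 \<le> x" "\<phi>1 x = a" using inverse_step[of a] ab by (auto simp: x_def)
    have "a powr (\<delta> / 8) \<le> (x ^ 4) powr (\<delta> / 8)"
      using elim(2) x px ab T01 Suc.prems by (intro powr_mono2) auto
    also have "x ^ 4 = x powr 4" using x T01 by simp
    also have "(x powr 4) powr (\<delta> / 8) = x powr (\<delta> / 2)" by (simp add: powr_powr)
    finally have "b \<le> \<phi>1 (x + x powr \<delta>)"
      using elim(1,3) x unfolding px a_def[symmetric] b_def[symmetric] by linarith
    then show ?case
      using less_inverse_step_iff[of b "x + x powr \<delta>"] ab x unfolding px by (smt (verit) powr_ge_zero)
  qed
qed

end

section \<open>The zeta quotients\<close>

locale jacob_ladder = zeta_ladder +
  fixes T0 :: real
  assumes T0: "T0 \<le> T1"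
    and mono_phi1: "mono_on {T0..} \<phi>1"
    and omega_lim: "((\<lambda>t. \<omega> t / ln t) \<longlongrightarrow> 1) at_top"
begin

sublocale growing_ladder T0 T1 \<phi>1
  by unfold_locales
     (use T0 T1_pos mono_phi1 strict_mono_on_phi1 continuous_on_phi1 phi1_growth phi1_le_power4 in auto)

text \<open>A factor 2 changes the logarithm by at most ln 2, which is negligible against ln
  v.\<close>

lemma omega_ratio_tendsto:
  fixes u v :: "nat \<Rightarrow> real"
  assumes u: "filterlim u at_top sequentially" and v: "filterlim v at_top sequentially"
    and uv: "\<forall>\<^sub>F n in sequentially. u n \<le> 2 * v n" "\<forall>\<^sub>F n in sequentially. v n \<le> 2 * u n"
  shows "(\<lambda>n. \<omega> (u n) / \<omega> (v n)) \<longlonglongrightarrow> 1"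
proof -
  have gt: "\<forall>\<^sub>F n in sequentially. 1 < u n" "\<forall>\<^sub>F n in sequentially. 1 < v n"
    using u v by (auto simp: filterlim_at_top_dense)
  have ln_v: "filterlim (\<lambda>n. ln (v n)) at_top sequentially"
    using filterlim_compose[OF ln_at_top v] .
  have "(\<lambda>n. (ln (u n) - ln (v n)) / ln (v n)) \<longlonglongrightarrow> 0"
  proof (rule Lim_null_comparison)
    show "(\<lambda>n. ln 2 / ln (v n)) \<longlonglongrightarrow> 0"
      by (intro real_tendsto_divide_at_top[OF tendsto_const] ln_v)
    show "\<forall>\<^sub>F n in sequentially. norm ((ln (u n) - ln (v n)) / ln (v n)) \<le> ln 2 / ln (v n)"
      using gt uv
    proof eventually_elim
      case (elim n)
      have "ln (u n) \<le> ln (2 * v n)" "ln (v n) \<le> ln (2 * u n)" using elim by auto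
      then have "\<bar>ln (u n) - ln (v n)\<bar> \<le> ln 2" using elim by (auto simp: ln_mult)
      then show ?case using elim by (simp add: divide_right_mono)
    qed
  qed
  from tendsto_add[OF this tendsto_const[of 1]]
  have lim: "(\<lambda>n. (ln (u n) - ln (v n)) / ln (v n) + 1) \<longlonglongrightarrow> 1" by simp
  have "(\<lambda>n. (\<omega> (u n) / ln (u n)) / (\<omega> (v n) / ln (v n)) * ((ln (u n) - ln (v n)) / ln (v n) + 1)) \<longlonglongrightarrow> 1 / 1 * 1"
    by (intro tendsto_intros lim filterlim_compose[OF omega_lim] u v) auto
  moreover have "\<forall>\<^sub>F n in sequentially. (\<omega> (u n) / ln (u n)) / (\<omega> (v n) / ln (v n)) *
      ((ln (u n) - ln (v n)) / ln (v n) + 1) = \<omega> (u n) / \<omega> (v n)"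
    using gt by eventually_elim (simp add: field_simps)
  ultimately show ?thesis by (simp add: tendsto_cong)
qed

lemma iterates_between:
  assumes T: "filterlim T at_top sequentially"
    and d: "\<forall>\<^sub>F L in sequentially.
      d L \<in> {ladder_preimage T0 \<phi>1 k (T L)<..<ladder_preimage T0 \<phi>1 k (T L + U)}"
  shows "\<forall>\<^sub>F L in sequentially. regular k (T L) \<and> (\<forall>j\<le>k. (inverse_step ^^ (k - j)) (T L) < (\<phi>1 ^^ j) (d L) \<and>
      (\<phi>1 ^^ j) (d L) < (inverse_step ^^ (k - j)) (T L + U))"
proof -
  have TU: "filterlim (\<lambda>L. T L + U) at_top sequentially"
    by (rule filterlim_compose[OF _ T]) real_asymp
  show ?thesis
    using eventually_compose_filterlim[OF eventually_regular[of k] T]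
      eventually_compose_filterlim[OF eventually_regular[of k] TU] d
  proof eventually_elim
    case (elim L)
    then show ?case using between_preimages[of k "T L" "T L + U" "d L"]
      by (simp add: ladder_preimage_eq)
  qed
qed

lemma omega_iterates_ratio_tendsto:
  assumes T: "filterlim T at_top sequentially" and "j < k"
    and d: "\<forall>\<^sub>F L in sequentially.
      d L \<in> {ladder_preimage T0 \<phi>1 k (T L)<..<ladder_preimage T0 \<phi>1 k (T L + U)}"
    and e: "\<forall>\<^sub>F L in sequentially.
      e L \<in> {ladder_preimage T0 \<phi>1 k (T L)<..<ladder_preimage T0 \<phi>1 k (T L + U)}"
  shows "(\<lambda>L. \<omega> ((\<phi>1 ^^ j) (d L)) / \<omega> ((\<phi>1 ^^ j) (e L))) \<longlonglongrightarrow> 1"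
proof -
  let ?p = "\<lambda>L. (inverse_step ^^ (k - j)) (T L)"
  have p: "filterlim ?p at_top sequentially"
    by (rule filterlim_compose[OF filterlim_inverse_step_pow T])
  \<comment> \<open>The exponent 1 already gives the factor 2; smaller exponents serve the induction
    behind \<open>preimage_gap\<close>.\<close>
  have "\<forall>\<^sub>F L in sequentially. (inverse_step ^^ (k - j)) (T L + U) \<le> ?p L + ?p L powr 1"
    by (rule eventually_compose_filterlim[OF preimage_gap T]) auto
  moreover have "\<forall>\<^sub>F L in sequentially. 0 < ?p L"
    using p by (simp add: filterlim_at_top_dense)
  moreover note iterates_between[OF T d] iterates_between[OF T e]
  ultimately have ev: "\<forall>\<^sub>F L in sequentially. ?p L \<le> (\<phi>1 ^^ j) (d L) \<and> ?p L \<le> (\<phi>1 ^^ j) (e L) \<and>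
     (\<phi>1 ^^ j) (d L) \<le> 2 * ?p L \<and> (\<phi>1 ^^ j) (e L) \<le> 2 * ?p L"
  proof eventually_elim
    case (elim L)
    from elim(3,4) \<open>j < k\<close> have
      "?p L < (\<phi>1 ^^ j) (d L)" "(\<phi>1 ^^ j) (d L) < (inverse_step ^^ (k - j)) (T L + U)"
      "?p L < (\<phi>1 ^^ j) (e L)" "(\<phi>1 ^^ j) (e L) < (inverse_step ^^ (k - j)) (T L + U)" by simp_all
    with elim(1,2) show ?case by simp
  qed
  show ?thesis
  proof (rule omega_ratio_tendsto)
    show "filterlim (\<lambda>L. (\<phi>1 ^^ j) (d L)) at_top sequentially"
         "filterlim (\<lambda>L. (\<phi>1 ^^ j) (e L)) at_top sequentially"
      by (rule filterlim_at_top_mono[OF p], rule eventually_mono[OF ev], blast)+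
    show "\<forall>\<^sub>F L in sequentially. (\<phi>1 ^^ j) (d L) \<le> 2 * (\<phi>1 ^^ j) (e L)"
         "\<forall>\<^sub>F L in sequentially. (\<phi>1 ^^ j) (e L) \<le> 2 * (\<phi>1 ^^ j) (d L)"
      by (rule eventually_mono[OF ev], linarith)+
  qed
qed

lemma zeta_quotient_eq:
  assumes d: "\<And>j. j < k \<Longrightarrow> T1 \<le> (\<phi>1 ^^ j) d" and e: "\<And>j. j < k \<Longrightarrow> T1 \<le> (\<phi>1 ^^ j) e"
  shows "zeta_quotient \<phi>1 k d e = (\<Prod>j<k. \<omega> ((\<phi>1 ^^ j) d) / \<omega> ((\<phi>1 ^^ j) e)) *
    ((\<Prod>j<k. deriv \<phi>1 ((\<phi>1 ^^ j) d)) / (\<Prod>j<k. deriv \<phi>1 ((\<phi>1 ^^ j) e)))"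
proof -
  have zeta_sq: "(norm (zeta_crit t))\<^sup>2 = \<omega> t * deriv \<phi>1 t" if "T1 \<le> t" for t
    using DERIV_imp_deriv[OF deriv[OF that]] omega_pos[OF that] by simp
  have "zeta_quotient \<phi>1 k d e =
     (\<Prod>j<k. (norm (zeta_crit ((\<phi>1 ^^ j) d) / zeta_crit ((\<phi>1 ^^ j) e)))\<^sup>2)"
    unfolding zeta_quotient_def assoc_pt_def
    \<comment> \<open>The index r corresponds to j = k - r, so r = 1..k becomes j < k; the missing r
      = 0 is the point at which the function itself is evaluated.\<close>
    by (rule prod.reindex_bij_witness[of _ "\<lambda>j. k - j" "\<lambda>r. k - r"]) auto
  also have "\<dots> = (\<Prod>j<k. (\<omega> ((\<phi>1 ^^ j) d) / \<omega> ((\<phi>1 ^^ j) e)) *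
     (deriv \<phi>1 ((\<phi>1 ^^ j) d) / deriv \<phi>1 ((\<phi>1 ^^ j) e)))"
    by (rule prod.cong) (simp_all add: norm_divide power_divide zeta_sq d e)
  finally show ?thesis by (simp add: prod.distrib prod_dividef)
qed

text \<open>The result is an exact equation with a factor tending to 1, so that real powers of it
  can be taken later. The function may depend on L because (t - \<pi>L)^\<Delta> does.\<close>

lemma zeta_quotient_asymptotics:
  assumes T: "filterlim T at_top sequentially" and "0 < U"
    and d: "\<forall>\<^sub>F L in sequentially. mean_value_point T0 \<phi>1 U (T L) k (f L) (d L)"
    and e: "\<forall>\<^sub>F L in sequentially. mean_value_point T0 \<phi>1 U (T L) k (\<lambda>t. 1) (e L)"
    and I: "\<forall>\<^sub>F L in sequentially. integral {T L..T L + U} (f L) = I" "I \<noteq> 0"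
  obtains R where "R \<longlonglongrightarrow> 1"
    "\<forall>\<^sub>F L in sequentially. assoc_pt \<phi>1 k (d L) 0 \<in> {T L<..<T L + U} \<and>
       f L (assoc_pt \<phi>1 k (d L) 0) \<noteq> 0 \<and>
       zeta_quotient \<phi>1 k (d L) (e L) = R L * (I / (U * f L (assoc_pt \<phi>1 k (d L) 0)))"
proof
  let ?R = "\<lambda>L. \<Prod>j<k. \<omega> ((\<phi>1 ^^ j) (d L)) / \<omega> ((\<phi>1 ^^ j) (e L))"
  have in_d: "\<forall>\<^sub>F L in sequentially.
      d L \<in> {ladder_preimage T0 \<phi>1 k (T L)<..<ladder_preimage T0 \<phi>1 k (T L + U)}"
    using d by eventually_elim (simp add: mean_value_point_def)
  have in_e: "\<forall>\<^sub>F L in sequentially.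
      e L \<in> {ladder_preimage T0 \<phi>1 k (T L)<..<ladder_preimage T0 \<phi>1 k (T L + U)}"
    using e by eventually_elim (simp add: mean_value_point_def)
  have "?R \<longlonglongrightarrow> (\<Prod>j<k. 1)"
    by (intro tendsto_prod omega_iterates_ratio_tendsto[OF T _ in_d in_e]) auto
  then show "?R \<longlonglongrightarrow> 1" by simp
  show "\<forall>\<^sub>F L in sequentially. assoc_pt \<phi>1 k (d L) 0 \<in> {T L<..<T L + U} \<and>
       f L (assoc_pt \<phi>1 k (d L) 0) \<noteq> 0 \<and>
       zeta_quotient \<phi>1 k (d L) (e L) = ?R L * (I / (U * f L (assoc_pt \<phi>1 k (d L) 0)))"
    using d e I(1) iterates_between[OF T in_d] iterates_between[OF T in_e]
  proof eventually_elim
    case (elim L)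
    define \<alpha> where "\<alpha> = (\<phi>1 ^^ k) (d L)"
    define D where "D = (\<Prod>j<k. deriv \<phi>1 ((\<phi>1 ^^ j) (d L)))"
    define E where "E = (\<Prod>j<k. deriv \<phi>1 ((\<phi>1 ^^ j) (e L)))"
    define len where "len = ladder_preimage T0 \<phi>1 k (T L + U) - ladder_preimage T0 \<phi>1 k (T L)"
    \<comment> \<open>The second equation is the mean value identity for the constant 1. As U > 0,
      it also shows that E and the length are nonzero, so dividing by them is legitimate.\<close>
    have 1: "I = f L \<alpha> * D * len" "U = E * len"
      using elim(1-3) \<open>0 < U\<close> by (simp_all add: mean_value_point_def \<alpha>_def D_def E_def len_def)
    have \<alpha>: "\<alpha> \<in> {T L<..<T L + U}" using elim(4) by (auto simp: \<alpha>_def dest: spec[of _ k])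
    have T1_le: "T1 \<le> (inverse_step ^^ (k - j)) (T L)" for j
      using elim(4) unfolding regular_def by (meson diff_le_self less_imp_le max.strict_boundedE)
    have "T1 \<le> (\<phi>1 ^^ j) (d L)" "T1 \<le> (\<phi>1 ^^ j) (e L)" if "j < k" for j
      using that elim(4,5) T1_le[of j] by (meson less_imp_le order_trans)+
    then have "zeta_quotient \<phi>1 k (d L) (e L) = ?R L * (D / E)"
      unfolding D_def E_def by (rule zeta_quotient_eq)
    also have "D / E = I / (U * f L \<alpha>)"
      using 1 \<open>I \<noteq> 0\<close> \<open>0 < U\<close> by (auto simp: field_simps)
    finally have "zeta_quotient \<phi>1 k (d L) (e L) = ?R L * (I / (U * f L \<alpha>))" .
    moreover have "f L \<alpha> \<noteq> 0" using 1 \<open>I \<noteq> 0\<close> by auto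
    ultimately show ?case using \<alpha> by (simp add: \<alpha>_def assoc_pt_def)
  qed
qed

end

section \<open>The three integrals\<close>

lemma cos_nonzero_shifted:
  assumes "U < pi / 2" "t \<in> {pi * real L..pi * real L + U}"
  shows "cos t \<noteq> 0"
proof -
  have "cos (t - pi * real L) > 0"
    using assms by (intro cos_gt_zero_pi) auto
  then show ?thesis by (auto simp: cos_diff)
qed

lemma tan_shift: "tan (pi * real L + U) = tan U" "tan (pi * real L) = 0"
  using tan_periodic_nat[of U L] tan_periodic_nat[of 0 L] by (simp_all add: ac_simps)

lemma integral_inverse_cos_sq:
  assumes "0 < U" "U < pi / 2"
  shows "integral {pi * real L..pi * real L + U} (\<lambda>t. 1 / (cos t)\<^sup>2) = tan U"
proof -
  have "((\<lambda>t. 1 / (cos t)\<^sup>2) has_integral tan (pi * real L + U) - tan (pi * real L)) {pi * real L..pi * real L + U}"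
    using assms cos_nonzero_shifted[OF assms(2)]
    by (intro fundamental_theorem_of_calculus)
       (auto simp flip: has_real_derivative_iff_has_vector_derivative
          intro!: derivative_eq_intros simp: inverse_eq_divide)
  then show ?thesis by (simp add: tan_shift integral_unique)
qed

lemma integral_sin_sq_div_cos_4:
  assumes "0 < U" "U < pi / 2"
  shows "integral {pi * real L..pi * real L + U} (\<lambda>t. (sin t)\<^sup>2 / (cos t) ^ 4) = (tan U) ^ 3 / 3"
proof -
  have "((\<lambda>t. (sin t)\<^sup>2 / (cos t) ^ 4) has_integral
     (tan (pi * real L + U)) ^ 3 / 3 - (tan (pi * real L)) ^ 3 / 3) {pi * real L..pi * real L + U}"
  proof (rule fundamental_theorem_of_calculus)
    fix t assume t: "t \<in> {pi * real L..pi * real L + U}"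
    have "((\<lambda>t. (tan t) ^ 3 / 3) has_real_derivative (tan t)\<^sup>2 * inverse ((cos t)\<^sup>2))
       (at t within {pi * real L..pi * real L + U})"
      using cos_nonzero_shifted[OF assms(2) t] by (auto intro!: derivative_eq_intros)
    also have "(tan t)\<^sup>2 * inverse ((cos t)\<^sup>2) = (sin t)\<^sup>2 / (cos t) ^ 4"
      by (simp add: tan_def power_divide inverse_eq_divide flip: power_add)
    finally show "((\<lambda>t. (tan t) ^ 3 / 3) has_vector_derivative (sin t)\<^sup>2 / (cos t) ^ 4)
       (at t within {pi * real L..pi * real L + U})"
      by (simp add: has_real_derivative_iff_has_vector_derivative)
  qed (use assms in auto)
  then show ?thesis by (simp add: tan_shift integral_unique)
qed

lemma integral_shifted_powr:
  fixes a U \<Delta> :: real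
  assumes "0 < U" "0 < \<Delta>"
  shows "integral {a..a + U} (\<lambda>t. (t - a) powr \<Delta>) = U powr (\<Delta> + 1) / (\<Delta> + 1)"
proof -
  have "((\<lambda>t. (t - a) powr \<Delta>) has_integral
     (a + U - a) powr (\<Delta> + 1) / (\<Delta> + 1) - (a - a) powr (\<Delta> + 1) / (\<Delta> + 1)) {a..a + U}"
  \<comment> \<open>At the left end the base of the power is 0, where the derivative rule for
    \<open>powr\<close> fails; continuity suffices there.\<close>
  proof (rule fundamental_theorem_of_calculus_interior)
    show "continuous_on {a..a + U} (\<lambda>t. (t - a) powr (\<Delta> + 1) / (\<Delta> + 1))"
      using assms by (intro continuous_intros continuous_on_powr') auto
    fix x assume "x \<in> {a<..<a + U}"
    then have "((\<lambda>t. (t - a) powr (\<Delta> + 1) / (\<Delta> + 1)) has_real_derivative (x - a) powr \<Delta>) (at x)"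
      using assms by (auto intro!: derivative_eq_intros)
    then show "((\<lambda>t. (t - a) powr (\<Delta> + 1) / (\<Delta> + 1)) has_vector_derivative (x - a) powr \<Delta>) (at x)"
      by (simp add: has_real_derivative_iff_has_vector_derivative)
  qed (use assms in auto)
  then show ?thesis by (simp add: integral_unique)
qed

text \<open>With t = tan U, the exponents -3\<Delta>/2 and \<Delta>/2 are those for which the powers
  of t cancel and U^\<Delta> is left, the power that the third integral contributes after division
  by U.\<close>

lemma powr_identity:
  fixes \<Delta> U t c1 c2 s2 x R1 R2 Rb :: real
  assumes "0 < \<Delta>" "0 < U" "0 < t" "0 < c1" "0 < c2" "0 < s2" "0 < x" "0 < R1" "0 < R2"
  shows "Rb * ((U powr (\<Delta> + 1) / (\<Delta> + 1)) / (U * x powr \<Delta>)) =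
    (Rb * R1 powr (3 * \<Delta> / 2) * R2 powr (- \<Delta> / 2)) *
    (3 powr (\<Delta> / 2) / (1 + \<Delta>) * ((c1 ^ 3 * s2) / (x * c2\<^sup>2)) powr \<Delta> *
     (R1 * (t / (U * (1 / c1\<^sup>2)))) powr (- 3 * \<Delta> / 2) *
     (R2 * ((t ^ 3 / 3) / (U * (s2\<^sup>2 / c2 ^ 4)))) powr (\<Delta> / 2))"
    (is "Rb * ?l = _")
proof -
  let ?r = "R1 powr (3 * \<Delta> / 2) * R2 powr (- \<Delta> / 2) *
    (3 powr (\<Delta> / 2) / (1 + \<Delta>) * ((c1 ^ 3 * s2) / (x * c2\<^sup>2)) powr \<Delta> *
     (R1 * (t / (U * (1 / c1\<^sup>2)))) powr (- 3 * \<Delta> / 2) *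
     (R2 * ((t ^ 3 / 3) / (U * (s2\<^sup>2 / c2 ^ 4)))) powr (\<Delta> / 2))"
  \<comment> \<open>Logarithms turn the identity into a linear one. \<open>Rb\<close> has no sign
    condition and is split off beforehand.\<close>
  have "ln ?l = ln ?r"
    using assms by (simp add: ln_mult ln_div ln_powr ln_realpow add_ac) (simp add: field_simps)
  moreover have "0 < ?l" "0 < ?r" using assms by (auto intro!: mult_pos_pos divide_pos_pos)
  ultimately have "?l = ?r" by (metis ln_inj_iff)
  then show ?thesis by (simp only: mult.assoc)
qed

theorem mainTheorem3:
  fixes y0 T0 \<epsilon> U \<Delta> :: real
    and \<mu> \<phi> \<phi>1 \<omega> :: "real \<Rightarrow> real"
    and k0 kb k1 k2 :: nat
    and db d1 d2 :: "nat \<Rightarrow> real"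
    and e :: "nat \<Rightarrow> nat \<Rightarrow> real"
  assumes "ladder_weight y0 \<mu>"
    and "ladder_solution y0 \<mu> T0 \<phi>"
    and "\<phi>1 = (\<lambda>T. \<phi> T / 2)"
    and "\<forall>\<^sub>F t in at_top. (\<phi>1 has_real_derivative (cmod (zeta_crit t))\<^sup>2 / \<omega> t) (at t)"
    and "(\<lambda>t. \<omega> t / ln t - 1) \<in> O(\<lambda>t. ln (ln t) / ln t)"
    and "0 < \<epsilon>" "\<epsilon> < pi / 2" "0 < U" "U \<le> pi / 2 - \<epsilon>" "0 < \<Delta>"
    and "1 \<le> kb" "kb \<le> k0" "1 \<le> k1" "k1 \<le> k0" "1 \<le> k2" "k2 \<le> k0"
    and "\<forall>\<^sub>F L in sequentially.
           mean_value_point T0 \<phi>1 U (pi * real L) k1 (\<lambda>t. 1 / (cos t)\<^sup>2) (d1 L)"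
    and "\<forall>\<^sub>F L in sequentially.
           mean_value_point T0 \<phi>1 U (pi * real L) k2 (\<lambda>t. (sin t)\<^sup>2 / (cos t) ^ 4) (d2 L)"
    and "\<forall>\<^sub>F L in sequentially.
           mean_value_point T0 \<phi>1 U (pi * real L) kb (\<lambda>t. (t - pi * real L) powr \<Delta>) (db L)"
    and "\<And>k. 1 \<le> k \<Longrightarrow> k \<le> k0 \<Longrightarrow> \<forall>\<^sub>F L in sequentially.
           mean_value_point T0 \<phi>1 U (pi * real L) k (\<lambda>t. 1) (e k L)"
  shows "(\<lambda>L. zeta_quotient \<phi>1 kb (db L) (e kb L))
     \<sim>[sequentially]
       (\<lambda>L. 3 powr (\<Delta> / 2) / (1 + \<Delta>) *
          ((\<bar>(cos (assoc_pt \<phi>1 k1 (d1 L) 0)) ^ 3\<bar> * \<bar>sin (assoc_pt \<phi>1 k2 (d2 L) 0)\<bar>) /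
           ((assoc_pt \<phi>1 kb (db L) 0 - pi * real L) * (cos (assoc_pt \<phi>1 k2 (d2 L) 0))\<^sup>2)) powr \<Delta> *
          zeta_quotient \<phi>1 k1 (d1 L) (e k1 L) powr (- 3 * \<Delta> / 2) *
          zeta_quotient \<phi>1 k2 (d2 L) (e k2 L) powr (\<Delta> / 2))"
    (is "?f \<sim>[sequentially] ?g")
proof -
  have omega_lim: "((\<lambda>t. \<omega> t / ln t) \<longlongrightarrow> 1) at_top"
    by (rule tendsto_omega_div_ln[OF assms(5)])
  have U: "0 < U" "U < pi / 2" using assms(6,8,9) by auto
  have "\<forall>\<^sub>F t in at_top. (\<phi>1 has_real_derivative (cmod (zeta_crit t))\<^sup>2 / \<omega> t) (at t) \<and>
    ln t / 2 \<le> \<omega> t \<and> \<omega> t \<le> 2 * ln t"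
    using assms(4) eventually_gt_at_top[of 1] order_tendstoD(1)[OF omega_lim, of "1/2", simplified]
      order_tendstoD(2)[OF omega_lim, of 2, simplified]
    by eventually_elim (auto simp: field_simps)
  then obtain B where B: "\<And>t. B \<le> t \<Longrightarrow>
      (\<phi>1 has_real_derivative (cmod (zeta_crit t))\<^sup>2 / \<omega> t) (at t) \<and> ln t / 2 \<le> \<omega> t \<and> \<omega> t \<le> 2 * ln t"
    unfolding eventually_at_top_linorder by blast
  define T1 where "T1 = Max {B, T0, exp 1}"
  have T1: "B \<le> T1" "T0 \<le> T1" "exp 1 \<le> T1" by (simp_all add: T1_def)
  have "mono_on {T0..} \<phi>1"
    using ladder_solution_mono_on[OF assms(1,2)] unfolding assms(3) mono_on_def by simp
  with B T1 omega_lim interpret jacob_ladder T1 \<phi>1 \<omega> T0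
    by unfold_locales auto
  have piL: "filterlim (\<lambda>L. pi * real L) at_top sequentially"
    by real_asymp
  have tanU: "0 < tan U" using U by (rule tan_gt_zero)
  then have tanU': "tan U \<noteq> 0" by simp
  obtain R1 where R1: "R1 \<longlonglongrightarrow> 1" "\<forall>\<^sub>F L in sequentially.
       assoc_pt \<phi>1 k1 (d1 L) 0 \<in> {pi * real L<..<pi * real L + U} \<and>
       1 / (cos (assoc_pt \<phi>1 k1 (d1 L) 0))\<^sup>2 \<noteq> 0 \<and>
       zeta_quotient \<phi>1 k1 (d1 L) (e k1 L) =
         R1 L * (tan U / (U * (1 / (cos (assoc_pt \<phi>1 k1 (d1 L) 0))\<^sup>2)))"
    by (rule zeta_quotient_asymptotics[where I = "tan U", OF piL U(1) assms(17) assms(20)[OF assms(13,14)]])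
       (use tanU' in \<open>simp_all add: integral_inverse_cos_sq[OF U]\<close>)
  obtain R2 where R2: "R2 \<longlonglongrightarrow> 1" "\<forall>\<^sub>F L in sequentially.
       assoc_pt \<phi>1 k2 (d2 L) 0 \<in> {pi * real L<..<pi * real L + U} \<and>
       (sin (assoc_pt \<phi>1 k2 (d2 L) 0))\<^sup>2 / (cos (assoc_pt \<phi>1 k2 (d2 L) 0)) ^ 4 \<noteq> 0 \<and>
       zeta_quotient \<phi>1 k2 (d2 L) (e k2 L) =
         R2 L * ((tan U) ^ 3 / 3 /
           (U * ((sin (assoc_pt \<phi>1 k2 (d2 L) 0))\<^sup>2 / (cos (assoc_pt \<phi>1 k2 (d2 L) 0)) ^ 4)))"
    by (rule zeta_quotient_asymptotics[where I = "(tan U) ^ 3 / 3", OF piL U(1) assms(18) assms(20)[OF assms(15,16)]])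
       (use tanU' in \<open>simp_all add: integral_sin_sq_div_cos_4[OF U]\<close>)
  obtain Rb where Rb: "Rb \<longlonglongrightarrow> 1" "\<forall>\<^sub>F L in sequentially.
       assoc_pt \<phi>1 kb (db L) 0 \<in> {pi * real L<..<pi * real L + U} \<and>
       (assoc_pt \<phi>1 kb (db L) 0 - pi * real L) powr \<Delta> \<noteq> 0 \<and>
       zeta_quotient \<phi>1 kb (db L) (e kb L) =
         Rb L * (U powr (\<Delta> + 1) / (\<Delta> + 1) / (U * (assoc_pt \<phi>1 kb (db L) 0 - pi * real L) powr \<Delta>))"
    by (rule zeta_quotient_asymptotics[where I = "U powr (\<Delta> + 1) / (\<Delta> + 1)", OF piL U(1) assms(19) assms(20)[OF assms(11,12)]])
       (use U assms(10) in \<open>simp_all add: integral_shifted_powr\<close>)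
  \<comment> \<open>The quotient of the two sides of the claim: the error factors, the second and
    third with exponents opposite to those in the claim.\<close>
  let ?W = "\<lambda>L. Rb L * R1 L powr (3 * \<Delta> / 2) * R2 L powr (- \<Delta> / 2)"
  have "?W \<longlonglongrightarrow> 1 * 1 powr (3 * \<Delta> / 2) * 1 powr (- \<Delta> / 2)"
    by (intro tendsto_intros Rb R1 R2) auto
  then have W: "?W \<longlonglongrightarrow> 1" by simp
  have eq: "\<forall>\<^sub>F L in sequentially. ?W L * ?g L = ?f L"
    using R1(2) R2(2) Rb(2) order_tendstoD(1)[OF R1(1), of 0, simplified]
      order_tendstoD(1)[OF R2(1), of 0, simplified]
  proof eventually_elim
    case (elim L)
    let ?c1 = "\<bar>cos (assoc_pt \<phi>1 k1 (d1 L) 0)\<bar>" and ?c2 = "\<bar>cos (assoc_pt \<phi>1 k2 (d2 L) 0)\<bar>"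
      and ?s2 = "\<bar>sin (assoc_pt \<phi>1 k2 (d2 L) 0)\<bar>" and ?x = "assoc_pt \<phi>1 kb (db L) 0 - pi * real L"
    \<comment> \<open>Division by zero yields 0, so the nonvanishing of the two trigonometric
      quotients includes that of their denominators.\<close>
    have "0 < ?c1" "0 < ?c2" "0 < ?s2" "0 < ?x" using elim(1-3) by auto
    from powr_identity[OF assms(10) U(1) tanU this elim(4,5), of "Rb L"]
    show ?case using elim(1-3) by (simp only: power_abs power2_abs power_even_abs even_numeral)
  qed
  have "(\<lambda>L. ?W L * ?g L) \<sim>[sequentially] (\<lambda>L. 1 * ?g L)"
    by (intro asymp_equiv_mult asymp_equiv_refl tendsto_imp_asymp_equiv_const W) auto
  from asymp_equiv_transfer[OF this eq] show ?thesis by simp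
qed

end
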